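(* Let $\Gamma$ be a finite connected graph, $\rho$ a (flat unitary complex) line bundle on $\Gamma$ with $H_0(\Gamma;\rho)=0$, and $r\colon \Gamma_1\to\mathbb{R}_{+}$ a resistance function. Then, with respect to the modified inner product $\langle\ ,\ \rangle_R$, the hermitian (i.e. orthogonal) projection of $C_1(\Gamma;\rho)$ onto the subspace $H_1(\Gamma;\rho)$ is given by $$\frac{1}{\Delta}\sum_T w_T\,\bar T ,$$ where $T$ ranges over the $\rho$-spanning trees of $\Gamma$ and $\Delta=\sum_T w_T$.
   Context: Graphs. A graph $\Gamma$ is a one-dimensional CW complex with vertex set $\Gamma_0$ and edge set $\Gamma_1$; it is given by a map $(d_0,d_1)\colon\Gamma_1\to\Gamma_0\times\Gamma_0$ sending an (oriented) edge to its initial and terminal endpoints. Loop edges ($d_0(b)=d_1(b)$) and multiple edges are allowed. For a subcomplex $A\subset\Gamma$, $A_0,A_1$ denote its vertices and edges. A circuit is a simple closed path (a loop edge, or two parallel edges, may form a circuit). Line bundle and holonomy. After choosing unit vectors in the fibers, a (flat unitary complex) line bundle $\rho$ on $\Gamma$ is a function $\Gamma_1\to U(1)$, $b\mapsto\rho_b$. For an oriented circuit $C$, the holonomy is $\rho_C=\prod_{b\in C_1}\rho_b^{s_b}$, where $s_b=1$ if the orientation of $b$ agrees with that of $C$ and $s_b=-1$ otherwise. Write $z^*$ for the complex conjugate of $z\in\mathbb{C}$. If $A\subset\Gamma$ is a subgraph each of whose connected components $A_\alpha$ has Euler characteristic zero, then each $A_\alpha$ has a unique circuit $C_\alpha$;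 orienting these arbitrarily, set $\hat\rho_A=\prod_\alpha(\rho_{C_\alpha}-1)(\rho_{C_\alpha}^*-1)$, a real number independent of the orientations. Twisted chains. $C_i(\Gamma;\rho)$ ($i=0,1$) is the complex vector space with basis $\Gamma_i$, and $\partial\colon C_1(\Gamma;\rho)\to C_0(\Gamma;\rho)$ is the linear map with $\partial b=\rho_b\,d_0(b)-d_1(b)$. $H_*(\Gamma;\rho)$ is the homology of this complex, so $H_1(\Gamma;\rho)=\ker\partial\subset C_1(\Gamma;\rho)$ and $H_0(\Gamma;\rho)=\operatorname{coker}\partial$. The same definitions apply to subcomplexes of $\Gamma$, with $\rho$ restricted. Inner products (linear in the first variable, conjugate-linear in the second). On $C_1(\Gamma;\rho)$ the standard Hermitian inner product is given on edges by $\langle b,b'\rangle=\delta_{bb'}$. For a resistance function $r$, $b\mapsto r_b>0$, the modified inner product is given on edges by $\langle b,b'\rangle_R=r_b\delta_{bb'}$. $\rho$-spanning trees. A $\rho$-spanning tree is a subcomplex $T\subset\Gamma$ with $T_0=\Gamma_0$, $H_1(T;\rho)=0$, and such that the inclusion induces an isomorphism $H_0(T;\rho)\to H_0(\Gamma;\rho)$. (Under the assumption $H_0(\Gamma;\rho)=0$, every component of a $\rho$-spanning tree has Euler characteristic zero, so $\hat\rho_T$ is defined.) The weight of $T$ is $w_T=\hat\rho_T\prod_{b\in T_1}r_b^{-1}$. The operator $\bar T\colon C_1(\Gamma;\rho)\to H_1(\Gamma;\rho)$ is the linear map defined as follows: $\bar T(b)=0$ if $b\in T_1$; if $b\in\Gamma_1\setminus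 T_1$, then $H_1(T\cup b;\rho)$ is one-dimensional, and for any nonzero $c$ in it, $\bar T(b)=c/t_b$ where $t_b=\langle c,b\rangle$ (independent of the choice of $c$), regarded in $H_1(\Gamma;\rho)\supset H_1(T\cup b;\rho)$. *)

theory Defs
  imports Complex_Main "Graph_Theory.Digraph_Component"
begin

text \<open>
  A finite graph with loops and multiple edges is a \<open>fin_digraph\<close>; \<open>tail\<close> and \<open>head\<close> are the
  endpoint maps d0 and d1. The arc directions only fix the orientation of the edges:
  connectedness and circuits below are undirected.
\<close>

definition line_bundle :: "('v,'e) pre_digraph \<Rightarrow> ('e \<Rightarrow> complex) \<Rightarrow> bool" where
  "line_bundle G \<rho> \<longleftrightarrow> (\<forall>b\<in>arcs G. cmod (\<rho> b) = 1)"


subsection \<open>Circuits and holonomy\<close>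

text \<open>
  Every arc \<open>b\<close> is replaced by two opposite arcs: \<open>(b, True)\<close> runs along \<open>b\<close> and \<open>(b, False)\<close>
  against it.
\<close>

definition oriented_double :: "('v,'e) pre_digraph \<Rightarrow> ('v, 'e \<times> bool) pre_digraph" where
  "oriented_double G =
     \<lparr> verts = verts G, arcs = arcs G \<times> UNIV,
       tail = (\<lambda>(b, s). if s then tail G b else head G b),
       head = (\<lambda>(b, s). if s then head G b else tail G b) \<rparr>"

text \<open>
  Distinctness of the underlying edges excludes going along an edge and straight back, which
  \<open>cycle\<close> would accept as a closed walk of length 2.
\<close>

definition oriented_circuit :: "('v,'e) pre_digraph \<Rightarrow> ('e \<times> bool) list \<Rightarrow> bool" where
  "oriented_circuit G p \<longleftrightarrow> pre_digraph.cycle (oriented_double G) p \<and> distinct (map fst p)"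

definition holonomy :: "('e \<Rightarrow> complex) \<Rightarrow> ('e \<times> bool) list \<Rightarrow> complex" where
  "holonomy \<rho> p = (\<Prod>(b, s)\<leftarrow>p. \<rho> b powi (if s then 1 else -1))"

definition components :: "('v,'e) pre_digraph \<Rightarrow> ('v,'e) pre_digraph set" where
  "components A = {K. pre_digraph.max_subgraph A Digraph_Component.connected K}"

text \<open>
  Meant for \<open>A\<close> all of whose components have Euler characteristic zero. Each component then has
  exactly one circuit, and the choice only fixes its orientation and starting point, on which the
  factor does not depend.
\<close>

definition rho_hat :: "('e \<Rightarrow> complex) \<Rightarrow> ('v,'e) pre_digraph \<Rightarrow> complex" where
  "rho_hat \<rho> A =
     (\<Prod>K\<in>components A.
        let z = holonomy \<rho> (SOME p. oriented_circuit K p) in (z - 1) * (cnj z - 1))"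


subsection \<open>Twisted chains and homology\<close>

text \<open>
  The complex vector space with basis a finite set \<open>B\<close> is realised as the functions that vanish
  outside \<open>B\<close>; \<open>single b\<close> is the basis vector of \<open>b\<close>. Chains of a subgraph are thereby literally
  chains of the whole graph.
\<close>

definition single :: "'b \<Rightarrow> 'b \<Rightarrow> complex" where
  "single b = (\<lambda>x. if x = b then 1 else 0)"

definition C0 :: "('v,'e) pre_digraph \<Rightarrow> ('v \<Rightarrow> complex) set" where
  "C0 G = {x. \<forall>v. v \<notin> verts G \<longrightarrow> x v = 0}"

definition C1 :: "('v,'e) pre_digraph \<Rightarrow> ('e \<Rightarrow> complex) set" where
  "C1 G = {c. \<forall>b. b \<notin> arcs G \<longrightarrow> c b = 0}"

definition bdry :: "('v,'e) pre_digraph \<Rightarrow> ('e \<Rightarrow> complex) \<Rightarrow> ('e \<Rightarrow> complex) \<Rightarrow> 'v \<Rightarrow> complex" where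
  "bdry G \<rho> c =
     (\<lambda>v. \<Sum>b\<in>arcs G. c b * (\<rho> b * single (tail G b) v - single (head G b) v))"

definition H1 :: "('v,'e) pre_digraph \<Rightarrow> ('e \<Rightarrow> complex) \<Rightarrow> ('e \<Rightarrow> complex) set" where
  "H1 G \<rho> = {c \<in> C1 G. bdry G \<rho> c = (\<lambda>_. 0)}"

definition B0 :: "('v,'e) pre_digraph \<Rightarrow> ('e \<Rightarrow> complex) \<Rightarrow> ('v \<Rightarrow> complex) set" where
  "B0 G \<rho> = bdry G \<rho> ` C1 G"

definition homologous :: "('v,'e) pre_digraph \<Rightarrow> ('e \<Rightarrow> complex) \<Rightarrow> ('v \<Rightarrow> complex) rel" where
  "homologous G \<rho> = {(x, y). x \<in> C0 G \<and> y \<in> C0 G \<and> x - y \<in> B0 G \<rho>}"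

definition H0 :: "('v,'e) pre_digraph \<Rightarrow> ('e \<Rightarrow> complex) \<Rightarrow> ('v \<Rightarrow> complex) set set" where
  "H0 G \<rho> = C0 G // homologous G \<rho>"

text \<open>The zero class of \<open>H0 G \<rho>\<close> is the subspace \<open>B0 G \<rho>\<close> itself.\<close>

definition H0_vanishes :: "('v,'e) pre_digraph \<Rightarrow> ('e \<Rightarrow> complex) \<Rightarrow> bool" where
  "H0_vanishes G \<rho> \<longleftrightarrow> H0 G \<rho> = {B0 G \<rho>}"

text \<open>
  For a subgraph \<open>A\<close> of \<open>G\<close>, the map \<open>H0 A \<rho> \<rightarrow> H0 G \<rho>\<close> induced by inclusion enlarges each class
  to the class in \<open>G\<close> of its elements. It is linear, so it is an isomorphism iff it is bijective.
\<close>

definition H0_incl ::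
    "('v,'e) pre_digraph \<Rightarrow> ('e \<Rightarrow> complex) \<Rightarrow> ('v \<Rightarrow> complex) set \<Rightarrow> ('v \<Rightarrow> complex) set" where
  "H0_incl G \<rho> X = homologous G \<rho> `` X"


subsection \<open>Inner products and orthogonal projection\<close>

definition inner_R ::
    "('v,'e) pre_digraph \<Rightarrow> ('e \<Rightarrow> real) \<Rightarrow> ('e \<Rightarrow> complex) \<Rightarrow> ('e \<Rightarrow> complex) \<Rightarrow> complex" where
  "inner_R G r x y = (\<Sum>b\<in>arcs G. complex_of_real (r b) * x b * cnj (y b))"

abbreviation inner_std ::
    "('v,'e) pre_digraph \<Rightarrow> ('e \<Rightarrow> complex) \<Rightarrow> ('e \<Rightarrow> complex) \<Rightarrow> complex" where
  "inner_std G \<equiv> inner_R G (\<lambda>_. 1)"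

text \<open>
  \<open>P\<close> is the orthogonal projection of \<open>C\<close> onto its subspace \<open>S\<close>: it sends \<open>x\<close> to the \<open>S\<close>-part of
  its decomposition along \<open>S\<close> and the orthogonal complement of \<open>S\<close>.
\<close>

definition orthogonal_projection ::
    "(('e \<Rightarrow> complex) \<Rightarrow> ('e \<Rightarrow> complex) \<Rightarrow> complex) \<Rightarrow> ('e \<Rightarrow> complex) set \<Rightarrow>
     ('e \<Rightarrow> complex) set \<Rightarrow> (('e \<Rightarrow> complex) \<Rightarrow> ('e \<Rightarrow> complex)) \<Rightarrow> bool" where
  "orthogonal_projection ip C S P \<longleftrightarrow>
     (\<forall>x\<in>C. P x \<in> S \<and> (\<forall>s\<in>S. ip (x - P x) s = 0))"


subsection \<open>Twisted spanning trees\<close>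

definition rho_spanning_tree ::
    "('v,'e) pre_digraph \<Rightarrow> ('e \<Rightarrow> complex) \<Rightarrow> ('v,'e) pre_digraph \<Rightarrow> bool" where
  "rho_spanning_tree G \<rho> T \<longleftrightarrow>
     spanning T G \<and> H1 T \<rho> = {\<lambda>_. 0} \<and> bij_betw (H0_incl G \<rho>) (H0 T \<rho>) (H0 G \<rho>)"

definition tree_weight ::
    "('e \<Rightarrow> complex) \<Rightarrow> ('e \<Rightarrow> real) \<Rightarrow> ('v,'e) pre_digraph \<Rightarrow> complex" where
  "tree_weight \<rho> r T = rho_hat \<rho> T * (\<Prod>b\<in>arcs T. inverse (complex_of_real (r b)))"

text \<open>
  \<open>T_bar_edge\<close> is the value on the basis vector of \<open>b\<close> (the value does not depend on the chosen
  \<open>c\<close>), and \<open>T_bar\<close> its linear extension.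
\<close>

definition T_bar_edge ::
    "('v,'e) pre_digraph \<Rightarrow> ('e \<Rightarrow> complex) \<Rightarrow> ('v,'e) pre_digraph \<Rightarrow> 'e \<Rightarrow> ('e \<Rightarrow> complex)" where
  "T_bar_edge G \<rho> T b =
     (if b \<in> arcs T then (\<lambda>_. 0)
      else let c = (SOME c. c \<in> H1 (pre_digraph.add_arc T b) \<rho> \<and> c \<noteq> (\<lambda>_. 0));
               t = inner_std G c (single b)
           in (\<lambda>e. c e / t))"

definition T_bar ::
    "('v,'e) pre_digraph \<Rightarrow> ('e \<Rightarrow> complex) \<Rightarrow> ('v,'e) pre_digraph \<Rightarrow>
     ('e \<Rightarrow> complex) \<Rightarrow> ('e \<Rightarrow> complex)" where
  "T_bar G \<rho> T x = (\<lambda>e. \<Sum>b\<in>arcs G. x b * T_bar_edge G \<rho> T b e)"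

definition total_weight ::
    "('v,'e) pre_digraph \<Rightarrow> ('e \<Rightarrow> complex) \<Rightarrow> ('e \<Rightarrow> real) \<Rightarrow> complex" where
  "total_weight G \<rho> r = (\<Sum>T | rho_spanning_tree G \<rho> T. tree_weight \<rho> r T)"

end

theory Submission
  imports Defs "HOL-Combinatorics.Permutations" "HOL-Library.Function_Algebras"
begin

text \<open>
  Each \<open>T_bar\<close> is a projection of the 1-chains onto the cycle space: its values are cycles, and for
  a cycle \<open>s\<close> the difference of \<open>s\<close> and its image is a cycle supported on the tree, hence zero
  (\<open>T_bar_fixes_cycles\<close>). Any average of such projections is again one, so all that has to be proved
  is that the weights make the average self-adjoint (\<open>weighted_sum_hermitian\<close>).

  The matrix entry at \<open>(a, b)\<close> collects the trees \<open>T\<close> with \<open>a\<close> outside and \<open>b\<close> inside, whose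
  fundamental cycle \<open>z\<close> through \<open>a\<close> (normalised to 1 there) runs through \<open>b\<close>. Removing \<open>b\<close> and
  inserting \<open>a\<close> is a bijection onto the trees that contribute to the entry at \<open>(b, a)\<close>, and
  the fundamental cycle of the new tree is a multiple of \<open>z\<close>. The two contributions
  match exactly when \<open>rho_hat\<close> is multiplied by the squared modulus of \<open>z b\<close>
  (\<open>exchange_rho_hat\<close>).

  This last fact is Cramer's rule, once \<open>rho_hat \<rho> T\<close> is recognised as the squared modulus of the
  determinant of the boundary map of \<open>T\<close> (\<open>rho_hat_eq_det\<close>). To compute that determinant, choose a
  circuit in each component; on the circuits let every vertex choose the edge along which the
  circuit leaves it, and elsewhere an edge that leads closer to the circuits. As there are as many edges
  as vertices, this is a bijection between vertices and edges, and up to factors of modulus one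
  the row of a vertex is its basis vector minus a multiple of the basis vector of the next vertex. Off
  the circuits such rows do not change the determinant (\<open>det_on_forest\<close>), and a circuit with
  holonomy \<open>h\<close> contributes the factor \<open>1 - inverse h\<close> (\<open>det_on_cycle\<close>). Every component does contain
  a circuit, for otherwise parallel transport along it would be a nonzero functional that
  vanishes on all boundaries (\<open>component_has_circuit\<close>). Holonomy 1 would produce a cycle, so the weights are
  positive and their sum is not zero.
\<close>

section \<open>Determinants with rows indexed by a finite set\<close>

text \<open>
  The vertex type need not be finite and the vertex set varies with the graph, so the Leibniz formula is
  taken over the permutations of a set. The row of \<open>v\<close> is the vector \<open>x v\<close>.
\<close>

definition det_on :: "'v set \<Rightarrow> ('v \<Rightarrow> 'v \<Rightarrow> complex) \<Rightarrow> complex" where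
  "det_on V x = (\<Sum>p | p permutes V. of_int (sign p) * (\<Prod>v\<in>V. x v (p v)))"

lemma det_on_cong:
  assumes "\<And>v. v \<in> V \<Longrightarrow> x v = y v"
  shows "det_on V x = det_on V y"
  unfolding det_on_def by (intro sum.cong prod.cong arg_cong2[of _ _ _ _ "(*)"] refl) (auto simp: assms)

lemma det_on_upd:
  assumes "finite V" "v \<in> V"
  shows "det_on V (x(v := a)) =
    (\<Sum>p | p permutes V. of_int (sign p) * (a (p v) * (\<Prod>w\<in>V-{v}. x w (p w))))"
proof -
  have "(\<Prod>w\<in>V. (x(v := a)) w (p w)) = a (p v) * (\<Prod>w\<in>V-{v}. x w (p w))" for p
    using assms by (subst prod.remove[of V v]) (auto intro!: arg_cong2[of _ _ _ _ "(*)"] prod.cong)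
  then show ?thesis by (simp add: det_on_def)
qed

lemma det_on_add:
  assumes "finite V" "v \<in> V"
  shows "det_on V (x(v := \<lambda>z. a z + b z)) = det_on V (x(v := a)) + det_on V (x(v := b))"
  by (simp only: det_on_upd[OF assms] sum.distrib[symmetric]) (simp add: algebra_simps)

lemma det_on_scale:
  assumes "finite V" "v \<in> V"
  shows "det_on V (x(v := \<lambda>z. k * a z)) = k * det_on V (x(v := a))"
  by (simp only: det_on_upd[OF assms] sum_distrib_left) (simp add: algebra_simps)

lemma det_on_scale_rows:
  assumes "finite V"
  shows "det_on V (\<lambda>v z. k v * x v z) = (\<Prod>v\<in>V. k v) * det_on V x"
  by (simp add: det_on_def prod.distrib sum_distrib_left algebra_simps)

text \<open>
  Only the modulus will matter, and by this lemma it does not depend on how the edges of a graph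
  are matched with its vertices.
\<close>

lemma det_on_permute:
  assumes "finite V" "q permutes V"
  shows "det_on V (x \<circ> q) = of_int (sign q) * det_on V x"
proof -
  have *: "(\<Prod>v\<in>V. x (q v) (p (q v))) = (\<Prod>v\<in>V. x v (p v))" for p
    using prod.reindex_bij_betw[OF permutes_imp_bij[OF assms(2)], of "\<lambda>v. x v (p v)"] by simp
  have s: "sign (p \<circ> q) = sign p * sign q" if "p permutes V" for p
    using that assms by (meson permutation_permutes sign_compose)
  have "det_on V (x \<circ> q) = (\<Sum>p | p permutes V. of_int (sign (p \<circ> q)) * (\<Prod>v\<in>V. x (q v) ((p \<circ> q) v)))"
    unfolding det_on_def using sum_permutations_compose_right[OF assms(2), of "\<lambda>p. of_int (sign p) * (\<Prod>v\<in>V. x (q v) (p v))"]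
    by simp
  also have "\<dots> = (\<Sum>p | p permutes V. of_int (sign q) * (of_int (sign p) * (\<Prod>v\<in>V. x v (p v))))"
    by (intro sum.cong refl) (simp add: * s)
  finally show ?thesis by (simp add: det_on_def sum_distrib_left)
qed

lemma det_on_eq_rows:
  assumes "finite V" "v \<in> V" "w \<in> V" "v \<noteq> w" "x v = x w"
  shows "det_on V x = 0"
proof -
  have "x \<circ> transpose v w = x"
    using assms by (auto simp: fun_eq_iff transpose_def)
  then show ?thesis
    using det_on_permute[OF assms(1) permutes_swap_id[OF assms(2,3)], of x] assms(4)
    by (simp add: sign_swap_id)
qed

lemma det_on_add_rows:
  assumes V: "finite V" "v \<in> V" and W: "finite W" "W \<subseteq> V" "v \<notin> W"
  shows "det_on V (x(v := \<lambda>z. a z + (\<Sum>w\<in>W. k w * x w z))) = det_on V (x(v := a))"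
  using W
proof (induction W arbitrary: a)
  case (insert w W)
  have "det_on V (x(v := \<lambda>z. a z + (\<Sum>w\<in>insert w W. k w * x w z)))
      = det_on V (x(v := \<lambda>z. (a z + k w * x w z) + (\<Sum>w\<in>W. k w * x w z)))"
    using insert by (simp add: add.assoc)
  also have "\<dots> = det_on V (x(v := \<lambda>z. a z + k w * x w z))"
    using insert by (intro insert.IH) auto
  also have "\<dots> = det_on V (x(v := a)) + k w * det_on V (x(v := x w))"
    by (simp only: det_on_add[OF V] det_on_scale[OF V])
  also have "det_on V (x(v := x w)) = 0"
    using insert V by (intro det_on_eq_rows[of V v w]) auto
  finally show ?case by simp
qed simp

text \<open>
  Cramer's rule, in the form needed for replacing one vector of a basis by another.
\<close>

lemma det_on_pivot:
  assumes "finite V" "v \<in> V"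
  shows "det_on V (x(v := \<lambda>z. \<Sum>w\<in>V. k w * x w z)) = k v * det_on V x"
proof -
  have "(\<lambda>z. \<Sum>w\<in>V. k w * x w z) = (\<lambda>z. k v * x v z + (\<Sum>w\<in>V-{v}. k w * x w z))"
    using assms by (simp add: fun_eq_iff sum.remove)
  then have "det_on V (x(v := \<lambda>z. \<Sum>w\<in>V. k w * x w z)) = det_on V (x(v := \<lambda>z. k v * x v z))"
    using det_on_add_rows[OF assms, of "V-{v}" x "\<lambda>z. k v * x v z" k] assms by simp
  then show ?thesis by (simp add: det_on_scale[OF assms])
qed

lemma det_on_row_op:
  assumes "finite V" "v \<in> V" "w \<in> V" "v \<noteq> w"
  shows "det_on V (x(v := \<lambda>z. a z - k * x w z)) = det_on V (x(v := a))"
  using det_on_add_rows[of V v "{w}" x a "\<lambda>_. - k"] assms by simp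

lemma det_on_single:
  assumes "finite V"
  shows "det_on V single = 1"
proof -
  have "(\<Prod>v\<in>V. single v (p v)) = (if p = id then 1 else 0)" if "p permutes V" for p
  proof (cases "p = id")
    case False
    then obtain v where "p v \<noteq> v" by (auto simp: fun_eq_iff)
    moreover from this have "v \<in> V" using that permutes_not_in by metis
    ultimately show ?thesis using assms False by (auto simp: single_def intro!: prod_zero)
  qed (simp add: single_def)
  then have "det_on V single = (\<Sum>p | p permutes V. if p = id then 1 else 0)"
    unfolding det_on_def by (intro sum.cong) auto
  then show ?thesis
    using assms by (simp add: sum.delta finite_permutations permutes_id)
qed

text \<open>
  The rows of \<open>x\<close> at \<open>vs @ [w]\<close> belong to a directed cycle: each vertex is joined to the next one,
  and \<open>w\<close>, with coefficient \<open>c\<close>, back to the first. Adding \<open>c\<close> times the row of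
  the first vertex to the row of \<open>w\<close> cuts the first vertex out of the cycle and
  multiplies \<open>c\<close> by its coefficient; the induction ends with a loop at \<open>w\<close>. The closing coefficient is kept separate from
  \<open>u\<close> so that the induction can change it.
\<close>

lemma det_on_cycle:
  assumes "finite V" "distinct (vs @ [w])" "set (vs @ [w]) \<subseteq> V"
    and "\<And>v. v \<in> set (vs @ [w]) \<Longrightarrow> y v = single v"
    and "\<And>v. v \<notin> set (vs @ [w]) \<Longrightarrow> x v = y v"
    and "\<And>i. i < length vs \<Longrightarrow>
      x (vs ! i) = (\<lambda>z. single (vs ! i) z - u (vs ! i) * single ((vs @ [w]) ! Suc i) z)"
    and "x w = (\<lambda>z. single w z - c * single (hd (vs @ [w])) z)"
  shows "det_on V x = (1 - c * (\<Prod>v\<leftarrow>vs. u v)) * det_on V y"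
  using assms(2-)
proof (induction vs arbitrary: c x y)
  case Nil
  have w: "w \<in> V" using Nil by simp
  have "det_on V x = det_on V (y(w := \<lambda>z. (1 - c) * single w z))"
    using Nil by (intro det_on_cong) (auto simp: algebra_simps)
  also have "\<dots> = (1 - c) * det_on V (y(w := single w))"
    by (rule det_on_scale[OF assms(1) w])
  also have "y(w := single w) = y" using Nil by auto
  finally show ?case by simp
next
  case (Cons v vs)
  let ?n = "hd (vs @ [w])"
  have n: "(vs @ [w]) ! 0 = ?n" by (simp add: hd_conv_nth)
  have nV: "?n \<in> V" "?n \<noteq> v" "?n \<in> set (vs @ [w])"
    using Cons.prems(1,2) by (cases vs; force)+
  have w: "w \<in> V" "w \<noteq> v" and v: "v \<in> V" using Cons.prems by auto
  have xv: "x v = (\<lambda>z. single v z - u v * single ?n z)"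
    using Cons.prems(5)[of 0] n by simp
  define y' where "y' = y(v := \<lambda>z. single v z - u v * y ?n z)"
  have yn: "y ?n = single ?n" using Cons.prems(3) nV by auto
  have yv: "y v = single v" using Cons.prems(3) by auto
  have dy: "det_on V y' = det_on V y"
    unfolding y'_def using det_on_row_op[OF assms(1) v nV(1), of y "single v" "u v"] nV(2) yv
    by (simp add: fun_upd_idem)
  \<comment> \<open>the row of \<open>w\<close> after the first vertex \<open>v\<close> has been cut out of the cycle\<close>
  define x' where "x' = x(w := \<lambda>z. single w z - (c * u v) * single ?n z)"
  have "x = x'(w := \<lambda>z. x' w z - c * x' v z)"
    using Cons.prems(6) w(2) by (simp add: x'_def xv fun_eq_iff algebra_simps)
  then have "det_on V x = det_on V x'"
    using det_on_row_op[OF assms(1) w(1) v w(2), of x' "x' w" c] by simp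
  also have "\<dots> = (1 - (c * u v) * (\<Prod>v\<leftarrow>vs. u v)) * det_on V y'"
  proof (rule Cons.IH)
    show "distinct (vs @ [w])" "set (vs @ [w]) \<subseteq> V" using Cons.prems by auto
    show "y' z = single z" if "z \<in> set (vs @ [w])" for z
      using that Cons.prems(1,3) by (auto simp: y'_def)
    show "x' z = y' z" if "z \<notin> set (vs @ [w])" for z
      using that Cons.prems(4)[of z] xv yn by (auto simp: x'_def y'_def)
    show "x' (vs ! i) = (\<lambda>z. single (vs ! i) z - u (vs ! i) * single ((vs @ [w]) ! Suc i) z)"
      if "i < length vs" for i
      using that Cons.prems(5)[of "Suc i"] Cons.prems(1) by (auto simp: x'_def)
    show "x' w = (\<lambda>z. single w z - (c * u v) * single (hd (vs @ [w])) z)"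
      by (simp add: x'_def)
  qed
  finally show ?case by (simp add: dy mult.assoc)
qed

text \<open>
  Along the arrows from \<open>v\<close> to \<open>g v\<close> that stay in \<open>W\<close> the function \<open>dist\<close> decreases, so the matrix is
  unitriangular when the rows are sorted by \<open>dist\<close>. The induction splits off a vertex where \<open>dist\<close> is least: it
  points outside \<open>W\<close>, to a row that is still a basis vector.
\<close>

lemma det_on_forest:
  fixes dist :: "'v \<Rightarrow> nat"
  assumes "finite V" "W \<subseteq> V"
    and "\<And>v. v \<in> W \<Longrightarrow> g v \<in> V \<and> (g v \<in> W \<longrightarrow> dist (g v) < dist v) \<and> g v \<noteq> v"
  shows "det_on V (\<lambda>v. if v \<in> W then (\<lambda>z. single v z - u v * single (g v) z) else single v) = 1"
proof -
  have "finite W" using assms finite_subset by blast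
  then show ?thesis using assms(2,3)
  proof (induction W rule: finite_psubset_induct)
    case (psubset W)
    show ?case
    proof (cases "W = {}")
      case True then show ?thesis by (simp add: det_on_single[OF assms(1)])
    next
      case False
      define v where "v = arg_min_on dist W"
      have v: "v \<in> W" "\<And>w. w \<in> W \<Longrightarrow> dist v \<le> dist w"
        using arg_min_if_finite[OF psubset.hyps False, of dist] unfolding v_def by (auto simp: not_less)
      have g: "g v \<notin> W" "g v \<in> V" "g v \<noteq> v" "v \<in> V"
        using psubset.prems v by (auto simp: not_less[symmetric])
      define y where "y = (\<lambda>v'. if v' \<in> W - {v} then (\<lambda>z. single v' z - u v' * single (g v') z) else single v')"
      have "(\<lambda>v. if v \<in> W then (\<lambda>z. single v z - u v * single (g v) z) else single v)
          = y(v := \<lambda>z. single v z - u v * y (g v) z)"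
        using g v by (auto simp: y_def fun_eq_iff)
      then have "det_on V (\<lambda>v. if v \<in> W then (\<lambda>z. single v z - u v * single (g v) z) else single v)
          = det_on V (y(v := single v))"
        using det_on_row_op[OF assms(1) g(4,2), of y "single v" "u v"] g(3) by auto
      also have "y(v := single v) = y" by (auto simp: y_def)
      also have "det_on V y = 1"
        unfolding y_def using v psubset.prems by (intro psubset.IH) auto
      finally show ?thesis .
    qed
  qed
qed

section \<open>Oriented edges\<close>

lemma verts_oriented_double[simp]: "verts (oriented_double G) = verts G"
  and arcs_oriented_double: "arcs (oriented_double G) = arcs G \<times> UNIV"
  and tail_oriented_double: "tail (oriented_double G) e = (if snd e then tail G (fst e) else head G (fst e))"
  and head_oriented_double: "head (oriented_double G) e = (if snd e then head G (fst e) else tail G (fst e))"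
  by (auto simp: oriented_double_def split: prod.splits)

lemmas oriented_double_simps = arcs_oriented_double tail_oriented_double head_oriented_double

lemma (in wf_digraph) wf_oriented_double: "wf_digraph (oriented_double G)"
  by unfold_locales (auto simp: oriented_double_simps)

lemma symmetric_oriented_double: "symmetric (oriented_double G)"
proof -
  have "\<exists>e'\<in>arcs (oriented_double G). tail (oriented_double G) e = head (oriented_double G) e' \<and>
      head (oriented_double G) e = tail (oriented_double G) e'"
    if "e \<in> arcs (oriented_double G)" for e
    using that by (intro bexI[of _ "(fst e, \<not> snd e)"]) (auto simp: oriented_double_simps)
  then show ?thesis by (auto simp: symmetric_conv)
qed

text \<open>
  Connectedness is defined by means of the simple symmetric graph of adjacent pairs, whereas circuits
  live in \<open>oriented_double\<close>, which remembers the edges. Both have the same adjacency relation.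
\<close>

lemma connected_iff_oriented_double:
  "Digraph_Component.connected H \<longleftrightarrow>
    verts H \<noteq> {} \<and> (\<forall>u\<in>verts H. \<forall>v\<in>verts H. u \<rightarrow>\<^sup>*\<^bsub>oriented_double H\<^esub> v)"
proof -
  have "parcs (mk_symmetric H) = arcs_ends (oriented_double H)"
    by (auto simp: parcs_mk_symmetric arcs_ends_conv oriented_double_simps image_iff)
      (metis UNIV_I snd_conv fst_conv mem_Sigma_iff)+
  then show ?thesis
    by (simp add: connected_def strongly_connected_def reachable_def)
qed

lemma subgraph_oriented_double:
  assumes "subgraph H G"
  shows "subgraph (oriented_double H) (oriented_double G)"
  using assms unfolding subgraph_def
  by (auto simp: wf_digraph.wf_oriented_double arcs_oriented_double compatible_def fun_eq_iff
      tail_oriented_double head_oriented_double)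

lemma oriented_double_subgraph_ends:
  assumes "subgraph H G"
  shows "tail (oriented_double H) = tail (oriented_double G)"
    and "head (oriented_double H) = head (oriented_double G)"
  using subgraph_oriented_double[OF assms] by (auto simp: subgraph_def compatible_def)

section \<open>Connected components\<close>

context wf_digraph
begin

definition component_of :: "'a \<Rightarrow> ('a,'b) pre_digraph" where
  "component_of v = G \<restriction> {w. v \<rightarrow>\<^sup>*\<^bsub>oriented_double G\<^esub> w}"

lemma subgraph_component_of: "subgraph (component_of v) G"
proof -
  interpret D: wf_digraph "oriented_double G" by (rule wf_oriented_double)
  have "{w. v \<rightarrow>\<^sup>*\<^bsub>oriented_double G\<^esub> w} \<subseteq> verts G"
    using D.reachable_in_verts(2) by auto
  then show ?thesis
    unfolding component_of_def by (intro induced_imp_subgraph induced_induce)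
qed

lemma connected_component_of:
  assumes "v \<in> verts G"
  shows "Digraph_Component.connected (component_of v)"
proof -
  interpret D: wf_digraph "oriented_double G" by (rule wf_oriented_double)
  let ?K = "component_of v"
  interpret K: wf_digraph ?K using subgraph_component_of by auto
  interpret DK: wf_digraph "oriented_double ?K" by (rule K.wf_oriented_double)
  have vK: "v \<in> verts ?K" using assms by (simp add: component_of_def)
  have reach: "v \<rightarrow>\<^sup>*\<^bsub>oriented_double ?K\<^esub> x" if "v \<rightarrow>\<^sup>*\<^bsub>oriented_double G\<^esub> x" for x
    using that
  proof (induction rule: D.reachable_induct)
    case base
    show ?case using vK by simp
  next
    case (step x y)
    from step.hyps(2) obtain e where e: "e \<in> arcs (oriented_double G)"
      "tail (oriented_double G) e = x" "head (oriented_double G) e = y" by auto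
    have "v \<rightarrow>\<^sup>*\<^bsub>oriented_double G\<^esub> y" using step.hyps by (rule D.reachable_adj_trans)
    then have "e \<in> arcs (oriented_double ?K)"
      using e step.hyps(1) by (auto simp: oriented_double_simps component_of_def split: if_splits)
    then have "x \<rightarrow>\<^bsub>oriented_double ?K\<^esub> y"
      using e(2,3) oriented_double_subgraph_ends[OF subgraph_component_of]
      by (metis DK.in_arcs_imp_in_arcs_ends)
    with step.IH show ?case by (rule DK.reachable_adj_trans)
  qed
  have "u \<rightarrow>\<^sup>*\<^bsub>oriented_double ?K\<^esub> w" if "u \<in> verts ?K" "w \<in> verts ?K" for u w
    using that symmetric_reachable[OF symmetric_oriented_double reach] reach
    by (metis DK.reachable_trans component_of_def induce_subgraph_verts mem_Collect_eq)
  then show ?thesis using vK by (auto simp: connected_iff_oriented_double)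
qed

lemma connected_subgraph_component_of:
  assumes "subgraph H G" "Digraph_Component.connected H" "v \<in> verts H"
  shows "subgraph H (component_of v)"
proof -
  interpret D: wf_digraph "oriented_double G" by (rule wf_oriented_double)
  interpret H: wf_digraph H using assms by auto
  have *: "v \<rightarrow>\<^sup>*\<^bsub>oriented_double G\<^esub> w" if "w \<in> verts H" for w
    using assms(2,3) that D.reachable_mono[OF _ subgraph_oriented_double[OF assms(1)]]
    by (auto simp: connected_iff_oriented_double)
  have t: "tail H = tail G" "head H = head G" using assms(1) by (auto simp: subgraph_def compatible_def)
  have "verts H \<subseteq> verts (component_of v)" using * by (auto simp: component_of_def)
  moreover have "arcs H \<subseteq> arcs (component_of v)"
    using * assms(1) H.tail_in_verts H.head_in_verts by (auto simp: component_of_def t)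
  moreover have "compatible (component_of v) H" using t by (simp add: compatible_def component_of_def)
  ultimately show ?thesis
    using subgraph_component_of[of v] assms(1) by (auto simp: subgraph_def)
qed

text \<open>
  Together with the next lemma this describes the maximal connected subgraphs as the subgraphs induced
  on the classes of mutual reachability, which makes it plain that they are disjoint and cover the graph.
\<close>

lemma components_eq_component_of:
  assumes "K \<in> components G" "v \<in> verts K"
  shows "K = component_of v"
proof -
  have K: "subgraph K G" "Digraph_Component.connected K"
    "\<And>H'. H' \<noteq> K \<Longrightarrow> subgraph K H' \<Longrightarrow> subgraph H' G \<Longrightarrow> \<not> Digraph_Component.connected H'"
    using assms(1) by (auto simp: components_def max_subgraph_def)
  have "v \<in> verts G" using K(1) assms(2) by auto
  then show ?thesis
    using K(3)[OF _ connected_subgraph_component_of[OF K(1,2) assms(2)] subgraph_component_of]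
      connected_component_of by blast
qed

lemma component_of_in_components:
  assumes "v \<in> verts G"
  shows "component_of v \<in> components G"
proof -
  have "H' = component_of v"
    if H: "subgraph (component_of v) H'" "subgraph H' G" "Digraph_Component.connected H'" for H'
  proof -
    interpret D: wf_digraph "oriented_double G" by (rule wf_oriented_double)
    have "v \<in> verts H'" using H(1) assms by (auto simp: component_of_def subgraph_def)
    from connected_subgraph_component_of[OF H(2,3) this] H(1)
    show ?thesis by (intro pre_digraph.equality) (auto simp: subgraph_def compatible_def)
  qed
  then show ?thesis
    using subgraph_component_of connected_component_of[OF assms]
    by (auto simp: components_def max_subgraph_def)
qed

lemma component_nonempty: "K \<in> components G \<Longrightarrow> verts K \<noteq> {}"
  by (auto simp: components_def max_subgraph_def connected_iff_oriented_double)

lemma component_subgraph: "K \<in> components G \<Longrightarrow> subgraph K G"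
  by (auto simp: components_def max_subgraph_def)

lemma component_connected: "K \<in> components G \<Longrightarrow> Digraph_Component.connected K"
  by (auto simp: components_def max_subgraph_def)

lemma component_closed:
  assumes "K \<in> components G" "b \<in> arcs G" "tail G b \<in> verts K \<or> head G b \<in> verts K"
  shows "b \<in> arcs K"
proof -
  interpret D: wf_digraph "oriented_double G" by (rule wf_oriented_double)
  obtain v where v: "K = component_of v"
    using component_nonempty[OF assms(1)] components_eq_component_of[OF assms(1)] by blast
  have "tail G b \<rightarrow>\<^bsub>oriented_double G\<^esub> head G b"
    using assms(2) D.in_arcs_imp_in_arcs_ends[of "(b, True)"] by (auto simp: oriented_double_simps)
  moreover have "head G b \<rightarrow>\<^bsub>oriented_double G\<^esub> tail G b"
    using assms(2) D.in_arcs_imp_in_arcs_ends[of "(b, False)"] by (auto simp: oriented_double_simps)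
  ultimately show ?thesis
    using assms(2,3) unfolding v by (auto simp: component_of_def dest: D.reachable_adj_trans)
qed

end

lemma (in fin_digraph) finite_components: "finite (components G)"
proof -
  have "components G \<subseteq> component_of ` verts G"
  proof
    fix K assume K: "K \<in> components G"
    then obtain v where "v \<in> verts K" using component_nonempty by blast
    then show "K \<in> component_of ` verts G"
      using components_eq_component_of[OF K] component_subgraph[OF K] by (auto simp: subgraph_def)
  qed
  then show ?thesis by (rule finite_subset) simp
qed

section \<open>Descent towards a set of vertices\<close>

text \<open>
  The first arc of a shortest walk to \<open>R\<close> decreases the distance to \<open>R\<close>.
\<close>

lemma (in wf_digraph) descending_arcs:
  assumes "\<And>v. v \<in> verts G \<Longrightarrow> \<exists>r\<in>R. v \<rightarrow>\<^sup>* r"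
  obtains dist :: "'a \<Rightarrow> nat" and f where
    "\<And>v. v \<in> verts G - R \<Longrightarrow> f v \<in> arcs G \<and> tail G (f v) = v \<and> dist (head G (f v)) < dist v"
proof -
  define dist where "dist v = (LEAST n. \<exists>r\<in>R. (v, r) \<in> arcs_ends G ^^ n)" for v
  have "\<exists>e. e \<in> arcs G \<and> tail G e = v \<and> dist (head G e) < dist v" if v: "v \<in> verts G - R" for v
  proof -
    obtain r where "r \<in> R" "(v, r) \<in> (arcs_ends G)\<^sup>*"
      using assms[of v] v reachable_conv by blast
    then have "\<exists>n. \<exists>r\<in>R. (v, r) \<in> arcs_ends G ^^ n" by (auto simp: rtrancl_power)
    then have "\<exists>r\<in>R. (v, r) \<in> arcs_ends G ^^ dist v" unfolding dist_def by (rule LeastI_ex)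
    then obtain r where r: "r \<in> R" "(v, r) \<in> arcs_ends G ^^ dist v" by blast
    have "dist v \<noteq> 0" using r v by (intro notI) auto
    then obtain m where m: "dist v = Suc m" by (cases "dist v") auto
    then obtain w where w: "(v, w) \<in> arcs_ends G" "(w, r) \<in> arcs_ends G ^^ m"
      using relpow_Suc_D2[of v r m "arcs_ends G"] r by auto
    have "dist w \<le> m" unfolding dist_def using w(2) r(1) by (auto intro: Least_le)
    with w(1) m show ?thesis by (auto simp: arcs_ends_conv)
  qed
  then have "\<exists>f. \<forall>v\<in>verts G - R. f v \<in> arcs G \<and> tail G (f v) = v \<and> dist (head G (f v)) < dist v"
    by (intro bchoice) blast
  then show ?thesis using that by blast
qed

text \<open>
  Two vertices that choose the same edge use it in opposite directions, so each would have to be closer than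
  the other.
\<close>

lemma descending_edges_inj:
  fixes dist :: "'v \<Rightarrow> nat"
  assumes "\<And>v. v \<in> U \<Longrightarrow> tail (oriented_double G) (F v) = v \<and> dist (head (oriented_double G) (F v)) < dist v"
  shows "inj_on (\<lambda>v. fst (F v)) U"
proof (rule inj_onI)
  fix v w assume *: "v \<in> U" "w \<in> U" "fst (F v) = fst (F w)"
  show "v = w"
  proof (cases "snd (F v) = snd (F w)")
    case True
    then have "F v = F w" using * by (simp add: prod_eq_iff)
    then show ?thesis using assms * by metis
  next
    case False
    then have "head (oriented_double G) (F v) = tail (oriented_double G) (F w)"
      "head (oriented_double G) (F w) = tail (oriented_double G) (F v)"
      using * by (auto simp: oriented_double_simps)
    then show ?thesis using assms[OF *(1)] assms[OF *(2)] by auto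
  qed
qed

section \<open>Circuits\<close>

text \<open>
  A walk that uses an edge twice, in whatever directions, comes back to an end of that edge.
\<close>

lemma (in wf_digraph) apath_oriented_double_distinct:
  assumes "pre_digraph.apath (oriented_double G) u p v"
  shows "distinct (map fst p)"
proof -
  interpret D: wf_digraph "oriented_double G" by (rule wf_oriented_double)
  show ?thesis using assms
  proof (induction p arbitrary: u)
    case (Cons e p)
    then have p: "D.apath (head (oriented_double G) e) p v"
      "tail (oriented_double G) e \<notin> set (D.awalk_verts (head (oriented_double G) e) p)"
      by (auto simp: D.apath_Cons_iff)
    have "fst e \<noteq> fst e'" if "e' \<in> set p" for e'
    proof
      assume "fst e = fst e'"
      then have "tail (oriented_double G) e \<in> {tail (oriented_double G) e', head (oriented_double G) e'}"
        by (auto simp: oriented_double_simps)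
      moreover have "{tail (oriented_double G) e', head (oriented_double G) e'}
          \<subseteq> set (D.awalk_verts (head (oriented_double G) e) p)"
        using D.awalk_verts_arc1[OF that] D.awalk_verts_arc2[OF D.awalkI_apath[OF p(1)] that] by auto
      ultimately show False using p(2) by auto
    qed
    then show ?case using Cons.IH[OF p(1)] by auto
  qed simp
qed

lemma (in pre_digraph) cas_consecutive:
  assumes "cas u p w"
  shows "p \<noteq> [] \<Longrightarrow> tail G (hd p) = u" "p \<noteq> [] \<Longrightarrow> head G (last p) = w"
    "Suc i < length p \<Longrightarrow> head G (p ! i) = tail G (p ! Suc i)"
proof -
  have "(p \<noteq> [] \<longrightarrow> tail G (hd p) = u \<and> head G (last p) = w) \<and>
      (Suc i < length p \<longrightarrow> head G (p ! i) = tail G (p ! Suc i))"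
    using assms
  proof (induction p arbitrary: u i)
    case (Cons e p)
    then have e: "tail G e = u" "cas (head G e) p w" by auto
    show ?case
      using e Cons.IH[OF e(2), of "i - 1"]
      by (cases p; cases i) auto
  qed simp
  then show "p \<noteq> [] \<Longrightarrow> tail G (hd p) = u" "p \<noteq> [] \<Longrightarrow> head G (last p) = w"
    "Suc i < length p \<Longrightarrow> head G (p ! i) = tail G (p ! Suc i)" by auto
qed

lemma (in pre_digraph) cycle_distinct_tails:
  assumes "cycle p"
  shows "distinct (map (tail G) p)"
proof -
  obtain u where u: "cas u p u" "distinct (tl (awalk_verts u p))" "p \<noteq> []"
    using assms by (auto simp: cycle_def awalk_def)
  have 1: "awalk_verts u p = map (tail G) p @ [u]"
    using u cas_consecutive(2)[OF u(1)] by (simp add: awalk_verts_conv)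
  have 2: "awalk_verts u p = u # map (head G) p"
    using u cas_consecutive(1)[OF u(1)] by (simp add: awalk_verts_conv'[OF u(1)])
  have "mset (map (tail G) p @ [u]) = mset (u # map (head G) p)" using 1 2 by simp
  then have "mset (map (tail G) p) = mset (map (head G) p)" by simp
  then show ?thesis using u(2) 2 mset_eq_imp_distinct_iff by fastforce
qed

section \<open>Twisted boundaries and circuits\<close>

definition edge_bdry :: "('v,'e) pre_digraph \<Rightarrow> ('e \<Rightarrow> complex) \<Rightarrow> 'e \<Rightarrow> 'v \<Rightarrow> complex" where
  "edge_bdry G \<rho> b = (\<lambda>v. \<rho> b * single (tail G b) v - single (head G b) v)"

lemma bdry_eq_edge_bdry: "bdry G \<rho> c = (\<lambda>v. \<Sum>b\<in>arcs G. c b * edge_bdry G \<rho> b v)"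
  by (simp add: bdry_def edge_bdry_def)

definition edge_holonomy :: "('e \<Rightarrow> complex) \<Rightarrow> 'e \<times> bool \<Rightarrow> complex" where
  "edge_holonomy \<rho> e = \<rho> (fst e) powi (if snd e then 1 else -1)"

text \<open>
  The coefficient of the starting vertex of an oriented edge in the boundary of the edge. It has modulus one, so it
  does not affect the modulus of a determinant.
\<close>

definition tail_coeff :: "('e \<Rightarrow> complex) \<Rightarrow> 'e \<times> bool \<Rightarrow> complex" where
  "tail_coeff \<rho> e = (if snd e then \<rho> (fst e) else -1)"

lemma holonomy_eq_prod_edges: "holonomy \<rho> p = (\<Prod>e\<leftarrow>p. edge_holonomy \<rho> e)"
  unfolding holonomy_def edge_holonomy_def by (simp add: case_prod_unfold)

text \<open>
  With respect to either orientation the boundary is the start minus a multiple of the end, up to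
  a factor; the multiple is what the holonomy of a circuit is made of.
\<close>

lemma edge_bdry_oriented:
  assumes "\<rho> (fst e) \<noteq> 0"
  shows "edge_bdry G \<rho> (fst e) = (\<lambda>v. tail_coeff \<rho> e *
    (single (tail (oriented_double G) e) v
      - inverse (edge_holonomy \<rho> e) * single (head (oriented_double G) e) v))"
  using assms
  by (auto simp: edge_bdry_def tail_coeff_def edge_holonomy_def oriented_double_simps fun_eq_iff
      right_diff_distrib mult.assoc[symmetric])

lemma sum_of_functions_apply: "(\<Sum>a\<in>A. f a) x = (\<Sum>a\<in>A. f a x)"
  for f :: "'a \<Rightarrow> 'b \<Rightarrow> 'c::comm_monoid_add"
  by (induction A rule: infinite_finite_induct) auto

locale twisted_graph = fin_digraph G for G :: "('v,'e) pre_digraph" +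
  fixes \<rho> :: "'e \<Rightarrow> complex"
  assumes unitary: "b \<in> arcs G \<Longrightarrow> cmod (\<rho> b) = 1"
begin

abbreviation "D \<equiv> oriented_double G"

sublocale D: wf_digraph "oriented_double G" by (rule wf_oriented_double)

lemma rho_nonzero: "b \<in> arcs G \<Longrightarrow> \<rho> b \<noteq> 0"
  using unitary by fastforce

lemma cmod_tail_coeff: "e \<in> arcs D \<Longrightarrow> cmod (tail_coeff \<rho> e) = 1"
  by (auto simp: tail_coeff_def unitary arcs_oriented_double)

lemma cmod_edge_holonomy: "e \<in> arcs D \<Longrightarrow> cmod (edge_holonomy \<rho> e) = 1"
  by (auto simp: edge_holonomy_def unitary arcs_oriented_double norm_inverse)

lemma edge_bdry_outside: "b \<in> arcs G \<Longrightarrow> v \<notin> verts G \<Longrightarrow> edge_bdry G \<rho> b v = 0"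
  using tail_in_verts[of b] head_in_verts[of b] by (auto simp: edge_bdry_def single_def)

lemma bdry_in_C0: "bdry G \<rho> c \<in> C0 G"
  by (auto simp: C0_def bdry_eq_edge_bdry edge_bdry_outside intro!: sum.neutral)

text \<open>
  Moving the starting vertex along a path changes its class by the inverse holonomy. The coefficient at the
  first edge shows that the chain is not zero when the path is closed.
\<close>

lemma chain_along_path:
  assumes "D.cas u p w" "set p \<subseteq> arcs D" "distinct (map fst p)"
  obtains c where "c \<in> C1 G" "\<And>b. b \<notin> fst ` set p \<Longrightarrow> c b = 0"
    "p \<noteq> [] \<Longrightarrow> c (fst (hd p)) \<noteq> 0"
    "bdry G \<rho> c = (\<lambda>v. single u v - inverse (holonomy \<rho> p) * single w v)"
proof -
  have "\<exists>c\<in>C1 G. (\<forall>b. b \<notin> fst ` set p \<longrightarrow> c b = 0) \<and> (p \<noteq> [] \<longrightarrow> c (fst (hd p)) \<noteq> 0) \<and>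
    bdry G \<rho> c = (\<lambda>v. single u v - inverse (holonomy \<rho> p) * single w v)"
    using assms
  proof (induction p arbitrary: u)
    case Nil
    then show ?case
      by (intro bexI[of _ "\<lambda>_. 0"]) (auto simp: C1_def bdry_eq_edge_bdry holonomy_eq_prod_edges)
  next
    case (Cons e p)
    have e: "e \<in> arcs D" "fst e \<in> arcs G" "tail D e = u" using Cons.prems by (auto simp: arcs_oriented_double)
    obtain c where c: "c \<in> C1 G" "\<And>b. b \<notin> fst ` set p \<Longrightarrow> c b = 0"
      "bdry G \<rho> c = (\<lambda>v. single (head D e) v - inverse (holonomy \<rho> p) * single w v)"
      using Cons.IH[of "head D e"] Cons.prems by auto
    let ?a = "tail_coeff \<rho> e" and ?h = "edge_holonomy \<rho> e"
    have a: "?a \<noteq> 0" using cmod_tail_coeff[OF e(1)] by fastforce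
    define c' where "c' = (\<lambda>b. inverse ?h * c b + (if b = fst e then inverse ?a else 0))"
    have "bdry G \<rho> c' v = inverse ?h * bdry G \<rho> c v + inverse ?a * edge_bdry G \<rho> (fst e) v" for v
      using e(2) by (simp add: bdry_eq_edge_bdry c'_def distrib_right sum.distrib sum_distrib_left
          mult.assoc if_distrib[of "\<lambda>x. x * _"] sum.delta cong: if_cong)
    moreover have "inverse ?a * edge_bdry G \<rho> (fst e) v = single u v - inverse ?h * single (head D e) v" for v
      using a by (simp add: e edge_bdry_oriented[where \<rho>=\<rho> and e=e and G=G, OF rho_nonzero[OF e(2)]]
          mult.assoc[symmetric])
    ultimately have "bdry G \<rho> c' = (\<lambda>v. single u v - inverse (holonomy \<rho> (e # p)) * single w v)"
      by (simp add: fun_eq_iff c(3) holonomy_eq_prod_edges right_diff_distrib mult.assoc)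
    moreover have "c' \<in> C1 G" using c(1) e(2) by (auto simp: c'_def C1_def)
    moreover have "c' b = 0" if "b \<notin> fst ` set (e # p)" for b
      using c(2) that by (auto simp: c'_def)
    moreover have "c' (fst e) \<noteq> 0" using c(2)[of "fst e"] Cons.prems(3) a by (simp add: c'_def)
    ultimately show ?case by (intro bexI[of _ c']) auto
  qed
  then show ?thesis using that by blast
qed

lemma oriented_circuit_subgraph:
  assumes "subgraph K G" "oriented_circuit K p"
  shows "oriented_circuit G p"
  using assms D.subgraph_cycle[OF subgraph_oriented_double[OF assms(1)]]
  by (auto simp: oriented_circuit_def)

lemma oriented_circuit_holonomy:
  assumes "H1 G \<rho> = {\<lambda>_. 0}" "oriented_circuit G p"
  shows "holonomy \<rho> p \<noteq> 1"
proof
  assume h: "holonomy \<rho> p = 1"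
  obtain u where p: "D.cas u p u" "set p \<subseteq> arcs D" "p \<noteq> []" "distinct (map fst p)"
    using assms(2) by (auto simp: oriented_circuit_def D.cycle_def D.awalk_def)
  obtain c where c: "c \<in> C1 G" "p \<noteq> [] \<Longrightarrow> c (fst (hd p)) \<noteq> 0"
    "bdry G \<rho> c = (\<lambda>v. single u v - inverse (holonomy \<rho> p) * single u v)"
    using chain_along_path[OF p(1,2,4)] by metis
  then have "c \<in> H1 G \<rho>" by (simp add: H1_def h)
  then show False using assms(1) c(2) p(3) by auto
qed

text \<open>
  Fix a vertex \<open>r0\<close> of the component, and let every other vertex choose an edge towards \<open>r0\<close>. There is a functional \<open>\<phi>\<close>
  with value 1 at \<open>r0\<close> that vanishes on the boundaries of all the chosen edges: transport along
  these edges determines it. If every vertex is a boundary, some edge \<open>b\<close> has a boundary on which \<open>\<phi>\<close> does not vanish.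
  It was not chosen, so the chosen edges connect its ends to each other without it, and a simple path between
  them that avoids \<open>b\<close> is closed up by \<open>b\<close> to a circuit.
\<close>

lemma component_has_circuit:
  assumes surj: "B0 G \<rho> = C0 G" and K: "K \<in> components G"
  shows "\<exists>p. oriented_circuit K p"
proof -
  have sub: "subgraph K G" using component_subgraph[OF K] .
  interpret K: fin_digraph K using fin_digraph_subgraph[OF sub] .
  let ?DK = "oriented_double K"
  interpret DK: wf_digraph ?DK by (rule K.wf_oriented_double)
  have ends: "tail K = tail G" "head K = head G" "tail ?DK = tail D" "head ?DK = head D"
    using sub oriented_double_subgraph_ends[OF sub] by (auto simp: subgraph_def compatible_def)
  obtain r0 where r0: "r0 \<in> verts K" using component_nonempty[OF K] by blast
  have conn: "v \<rightarrow>\<^sup>*\<^bsub>?DK\<^esub> w" if "v \<in> verts K" "w \<in> verts K" for v w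
    using component_connected[OF K] that by (auto simp: connected_iff_oriented_double)
  have "\<And>v. v \<in> verts ?DK \<Longrightarrow> \<exists>s\<in>{r0}. v \<rightarrow>\<^sup>*\<^bsub>?DK\<^esub> s" using conn r0 by simp
  then obtain dist :: "'v \<Rightarrow> nat" and F where "\<And>v. v \<in> verts ?DK - {r0} \<Longrightarrow>
      F v \<in> arcs ?DK \<and> tail ?DK (F v) = v \<and> dist (head ?DK (F v)) < dist v"
    by (rule DK.descending_arcs[of "{r0}"]) blast+
  then have F: "\<And>v. v \<in> verts K - {r0} \<Longrightarrow>
      F v \<in> arcs ?DK \<and> tail D (F v) = v \<and> dist (head D (F v)) < dist v"
    by (simp add: ends)
  have "\<exists>\<phi>. \<forall>v. \<phi> v = (if v \<in> verts K then
      if v = r0 then 1 else inverse (edge_holonomy \<rho> (F v)) * \<phi> (head D (F v)) else 0)"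
  proof (rule dependent_wf_choice[of "measure dist"])
    show "(y = (if x \<in> verts K then
        if x = r0 then 1 else inverse (edge_holonomy \<rho> (F x)) * f (head D (F x)) else 0)) =
      (y = (if x \<in> verts K then
        if x = r0 then 1 else inverse (edge_holonomy \<rho> (F x)) * g (head D (F x)) else 0))"
      if "\<And>z. (z, x) \<in> measure dist \<Longrightarrow> f z = g z" for f g :: "'v \<Rightarrow> complex" and x y
      using that F[of x] by auto
  qed auto
  then obtain \<phi> where \<phi>: "\<And>v. \<phi> v = (if v \<in> verts K then
      if v = r0 then 1 else inverse (edge_holonomy \<rho> (F v)) * \<phi> (head D (F v)) else 0)" by blast
  have pair: "(\<Sum>v\<in>verts G. \<phi> v * edge_bdry G \<rho> b v) = \<rho> b * \<phi> (tail G b) - \<phi> (head G b)"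
    if "b \<in> arcs G" for b
    using that by (simp add: edge_bdry_def single_def right_diff_distrib sum_subtractf
        if_distrib[of "\<lambda>x. _ * x"] sum.delta' mult.commute cong: if_cong)
  have rG: "r0 \<in> verts G" using r0 sub by auto
  have "single r0 \<in> C0 G" using rG by (auto simp: C0_def single_def)
  then obtain c where c: "single r0 = bdry G \<rho> c" using surj by (auto simp: B0_def)
  have "(\<Sum>b\<in>arcs G. c b * (\<Sum>v\<in>verts G. \<phi> v * edge_bdry G \<rho> b v)) = (\<Sum>v\<in>verts G. \<phi> v * single r0 v)"
    unfolding c bdry_eq_edge_bdry
    by (simp only: sum_distrib_left, subst sum.swap) (simp add: algebra_simps)
  also have "\<dots> = 1"
    using rG r0 \<phi>[of r0] by (simp add: single_def if_distrib[of "\<lambda>x. _ * x"] sum.delta cong: if_cong)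
  finally have "\<exists>b\<in>arcs G. (\<Sum>v\<in>verts G. \<phi> v * edge_bdry G \<rho> b v) \<noteq> 0"
    by (metis (no_types, lifting) mult_eq_0_iff sum.neutral zero_neq_one)
  then obtain b where b: "b \<in> arcs G" "\<rho> b * \<phi> (tail G b) \<noteq> \<phi> (head G b)"
    using pair by auto
  have "tail G b \<in> verts K \<or> head G b \<in> verts K" using b(2) \<phi> by (metis mult_zero_right)
  then have bK: "b \<in> arcs K" using component_closed[OF K b(1)] by blast
  have bF: "fst (F v) \<noteq> b" if v: "v \<in> verts K - {r0}" for v
  proof
    assume "fst (F v) = b"
    moreover have "\<phi> (tail D (F v)) = inverse (edge_holonomy \<rho> (F v)) * \<phi> (head D (F v))"
      using \<phi>[of v] F[OF v] v by simp
    ultimately show False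
      using b(2) rho_nonzero[OF b(1)] by (auto simp: edge_holonomy_def oriented_double_simps split: if_splits)
  qed
  let ?K' = "K.del_arc b"
  have sub': "subgraph ?K' K"
    by (auto simp: subgraph_def K.wf_digraph_del_arc K.wf_digraph compatible_def)
  interpret K': wf_digraph ?K' using sub' by auto
  let ?D' = "oriented_double ?K'"
  interpret D': wf_digraph ?D' by (rule K'.wf_oriented_double)
  have ends': "tail ?D' = tail D" "head ?D' = head D"
    using oriented_double_subgraph_ends[OF sub'] ends by auto
  have to_r: "v \<rightarrow>\<^sup>*\<^bsub>?D'\<^esub> r0" if "v \<in> verts K" for v
    using that
  proof (induction "dist v" arbitrary: v rule: less_induct)
    case less
    show ?case
    proof (cases "v = r0")
      case False
      then have v: "v \<in> verts K - {r0}" using less by auto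
      have "F v \<in> arcs ?D'" using F[OF v] bF[OF v] by (auto simp: arcs_oriented_double)
      then have "v \<rightarrow>\<^bsub>?D'\<^esub> head D (F v)" using D'.in_arcs_imp_in_arcs_ends F[OF v] ends' by metis
      moreover have "head D (F v) \<in> verts K"
        using F[OF v] DK.head_in_verts[of "F v"] ends by simp
      then have "head D (F v) \<rightarrow>\<^sup>*\<^bsub>?D'\<^esub> r0" using less F[OF v] by blast
      ultimately show ?thesis by (rule D'.adj_reachable_trans)
    qed (use r0 in simp)
  qed
  have "head G b \<rightarrow>\<^sup>*\<^bsub>?D'\<^esub> tail G b"
    using to_r[of "head G b"] to_r[of "tail G b"] bK K.tail_in_verts[OF bK] K.head_in_verts[OF bK]
      symmetric_reachable[OF symmetric_oriented_double] D'.reachable_trans ends by metis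
  then obtain p where p: "D'.apath (head G b) p (tail G b)"
    using D'.reachable_apath by blast
  have "DK.apath (head G b) p (tail G b)"
    using DK.subgraph_apath_imp_apath[OF p subgraph_oriented_double[OF sub']] .
  then have p': "DK.awalk (head G b) p (tail G b)" "distinct (DK.awalk_verts (head G b) p)"
    by (auto simp: DK.apath_def)
  have "set p \<subseteq> arcs ?D'" using p by (auto simp: D'.apath_def D'.awalk_def)
  then have "b \<notin> fst ` set p" by (auto simp: arcs_oriented_double)
  moreover have "distinct (map fst p)" using K'.apath_oriented_double_distinct[OF p] .
  moreover have "DK.cycle ((b, True) # p)"
    unfolding DK.cycle_def using p' bK ends
    by (intro exI[of _ "tail G b"])
      (auto simp: DK.awalk_Cons_iff oriented_double_simps)
  ultimately have "oriented_circuit K ((b, True) # p)" by (auto simp: oriented_circuit_def)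
  then show ?thesis by blast
qed

text \<open>
  The boundaries of the edges are linearly independent vectors in the span of the vertices.
\<close>

lemma card_arcs_le_card_verts:
  assumes "H1 G \<rho> = {\<lambda>_. 0}"
  shows "card (arcs G) \<le> card (verts G)"
proof -
  interpret vs: vector_space "\<lambda>(a::complex) (f::'v \<Rightarrow> complex) v. a * f v"
    by unfold_locales (auto simp: fun_eq_iff algebra_simps)
  have zero: "c b = 0" if "(\<Sum>b\<in>arcs G. (\<lambda>v. c b * edge_bdry G \<rho> b v)) = 0" "b \<in> arcs G" for c b
  proof -
    have "(\<lambda>b. if b \<in> arcs G then c b else 0) \<in> H1 G \<rho>"
      using that(1) by (auto simp: H1_def C1_def bdry_eq_edge_bdry fun_eq_iff sum_of_functions_apply)
    then show ?thesis using assms that(2) by (auto simp: fun_eq_iff split: if_splits)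
  qed
  have inj: "inj_on (edge_bdry G \<rho>) (arcs G)"
  proof (rule inj_onI, rule ccontr)
    fix b b' assume *: "b \<in> arcs G" "b' \<in> arcs G" "edge_bdry G \<rho> b = edge_bdry G \<rho> b'" "b \<noteq> b'"
    \<comment> \<open>the difference of two edges with equal boundaries would be a cycle\<close>
    let ?c = "\<lambda>e. (if e = b then 1 else 0) - (if e = b' then 1 else (0::complex))"
    have "(\<Sum>e\<in>arcs G. (\<lambda>v. ?c e * edge_bdry G \<rho> e v)) = 0"
      using * by (auto simp: fun_eq_iff sum_of_functions_apply left_diff_distrib sum_subtractf
          if_distrib[of "\<lambda>x. x * _"] sum.delta cong: if_cong)
    from zero[OF this *(1)] show False using *(4) by simp
  qed
  have "vs.independent (edge_bdry G \<rho> ` arcs G)"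
  proof (rule vs.independent_if_scalars_zero)
    fix f x
    assume "(\<Sum>x\<in>edge_bdry G \<rho> ` arcs G. (\<lambda>v. f x * x v)) = 0" and x: "x \<in> edge_bdry G \<rho> ` arcs G"
    then have "(\<Sum>b\<in>arcs G. (\<lambda>v. f (edge_bdry G \<rho> b) * edge_bdry G \<rho> b v)) = 0"
      by (simp add: sum.reindex[OF inj])
    then show "f x = 0" using x zero[of "\<lambda>b. f (edge_bdry G \<rho> b)"] by auto
  qed simp
  moreover have "edge_bdry G \<rho> ` arcs G \<subseteq> vs.span (single ` verts G)"
  proof clarify
    fix b assume b: "b \<in> arcs G"
    have "edge_bdry G \<rho> b = (\<lambda>v. \<rho> b * single (tail G b) v) - (\<lambda>v. 1 * single (head G b) v)"
      by (simp add: edge_bdry_def fun_eq_iff)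
    also have "\<dots> \<in> vs.span (single ` verts G)"
      using b by (intro vs.span_diff vs.span_scale vs.span_base imageI) auto
    finally show "edge_bdry G \<rho> b \<in> vs.span (single ` verts G)" .
  qed
  ultimately have "card (edge_bdry G \<rho> ` arcs G) \<le> card (single ` verts G)"
    using vs.independent_span_bound[of "single ` verts G" "edge_bdry G \<rho> ` arcs G"] by simp
  then show ?thesis
    using card_image[OF inj] card_image_le[of "verts G" "single :: 'v \<Rightarrow> _"] by simp
qed

end

section \<open>Determinant of an invertible twisted boundary\<close>

text \<open>
  Two matchings of \<open>V\<close> with \<open>E\<close> differ by a permutation of \<open>V\<close>.
\<close>

lemma cmod_det_on_bij:
  assumes "finite V" "bij_betw f V E" "bij_betw g V E"
  shows "cmod (det_on V (\<lambda>v. a (g v))) = cmod (det_on V (\<lambda>v. a (f v)))"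
proof -
  define q where "q v = (if v \<in> V then the_inv_into V f (g v) else v)" for v
  have "bij_betw (the_inv_into V f \<circ> g) V V"
    using assms(3) bij_betw_the_inv_into[OF assms(2)] by (rule bij_betw_trans)
  then have "bij_betw q V V"
    by (subst bij_betw_cong[where g="the_inv_into V f \<circ> g"]) (auto simp: q_def)
  then have q: "q permutes V" by (rule bij_imp_permutes) (simp add: q_def)
  have "g v = f (q v)" if "v \<in> V" for v
    using that assms(2) bij_betwE[OF assms(3)] by (auto simp: q_def bij_betw_def f_the_inv_into_f)
  then have "det_on V (\<lambda>v. a (g v)) = det_on V ((\<lambda>v. a (f v)) \<circ> q)"
    by (intro det_on_cong) simp
  also have "\<dots> = of_int (sign q) * det_on V (\<lambda>v. a (f v))"
    using assms(1) q by (rule det_on_permute)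
  finally show ?thesis by (cases q rule: sign_cases) (simp_all add: norm_mult)
qed

context twisted_graph
begin

lemma circuit_properties:
  assumes "subgraph K G" "oriented_circuit K p"
  shows "p \<noteq> []" "set p \<subseteq> arcs (oriented_double K)" "distinct (map (tail D) p)" "distinct (map fst p)"
    "head D (last p) = tail D (hd p)"
    "Suc i < length p \<Longrightarrow> head D (p ! i) = tail D (p ! Suc i)"
proof -
  note ends = oriented_double_subgraph_ends[OF assms(1)]
  obtain u where p: "pre_digraph.awalk (oriented_double K) u p u" "p \<noteq> []"
    "pre_digraph.cycle (oriented_double K) p" "distinct (map fst p)"
    using assms(2) by (auto simp: oriented_circuit_def pre_digraph.cycle_def)
  then have c: "pre_digraph.cas (oriented_double K) u p u"
    by (simp add: pre_digraph.awalk_def)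
  show "p \<noteq> []" "distinct (map fst p)" by fact+
  show "set p \<subseteq> arcs (oriented_double K)" using p(1) by (simp add: pre_digraph.awalk_def)
  show "distinct (map (tail D) p)" using pre_digraph.cycle_distinct_tails[OF p(3)] ends by simp
  show "head D (last p) = tail D (hd p)"
    using pre_digraph.cas_consecutive(1,2)[OF c] p(2) ends by simp
  show "Suc i < length p \<Longrightarrow> head D (p ! i) = tail D (p ! Suc i)"
    using pre_digraph.cas_consecutive(3)[OF c] ends by simp
qed

lemma det_on_circuit:
  assumes "subgraph K G" "oriented_circuit K p"
    and y: "\<And>v. v \<in> tail D ` set p \<Longrightarrow> y v = single v"
    and x: "\<And>v. v \<notin> tail D ` set p \<Longrightarrow> x v = y v"
      "\<And>e. e \<in> set p \<Longrightarrow> x (tail D e) = (\<lambda>z. single (tail D e) z - inverse (edge_holonomy \<rho> e) * single (head D e) z)"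
  shows "det_on (verts G) x = (1 - inverse (holonomy \<rho> p)) * det_on (verts G) y"
proof -
  note p = circuit_properties[OF assms(1,2)]
  obtain q e where pq: "p = q @ [e]" using p(1) by (cases p rule: rev_cases) auto
  let ?vs = "map (tail D) q" and ?w = "tail D e"
  have vw: "?vs @ [?w] = map (tail D) p" by (simp add: pq)
  define u where "u v = inverse (edge_holonomy \<rho> (the_inv_into (set p) (tail D) v))" for v
  have u: "u (tail D e) = inverse (edge_holonomy \<rho> e)" if "e \<in> set p" for e
    using that p(3) by (simp add: u_def the_inv_into_f_f distinct_map)
  have sub: "set p \<subseteq> arcs D"
    using p(2) subgraph_oriented_double[OF assms(1)] by (auto simp: subgraph_def)
  have "det_on (verts G) x = (1 - inverse (edge_holonomy \<rho> e) * (\<Prod>v\<leftarrow>?vs. u v)) * det_on (verts G) y"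
  proof (rule det_on_cycle)
    show "finite (verts G)" by simp
    show "distinct (?vs @ [?w])" unfolding vw by (rule p(3))
    show "set (?vs @ [?w]) \<subseteq> verts G" unfolding vw using sub D.tail_in_verts by auto
    show "y v = single v" if "v \<in> set (?vs @ [?w])" for v using that y unfolding vw by simp
    show "x v = y v" if "v \<notin> set (?vs @ [?w])" for v using that x(1) unfolding vw by simp
    show "x (?vs ! i) = (\<lambda>z. single (?vs ! i) z - u (?vs ! i) * single ((?vs @ [?w]) ! Suc i) z)"
      if "i < length ?vs" for i
    proof -
      have i: "i < length p" "Suc i < length p" "q ! i = p ! i" "p ! i \<in> set p"
        using that by (auto simp: pq nth_append)
      then show ?thesis
        using x(2)[OF i(4)] u[OF i(4)] p(6)[OF i(2)] that unfolding vw by simp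
    qed
    show "x ?w = (\<lambda>z. single ?w z - inverse (edge_holonomy \<rho> e) * single (hd (?vs @ [?w])) z)"
      unfolding vw using x(2)[of e] p(1,5) by (simp add: hd_map) (simp add: pq)
  qed
  also have "(\<Prod>v\<leftarrow>?vs. u v) = (\<Prod>e\<leftarrow>q. inverse (edge_holonomy \<rho> e))"
    by (simp add: o_def u pq cong: map_cong)
  also have "\<dots> = inverse (\<Prod>e\<leftarrow>q. edge_holonomy \<rho> e)" by (induction q) simp_all
  finally show ?thesis by (simp add: holonomy_eq_prod_edges pq)
qed

lemma cmod_holonomy:
  assumes "set p \<subseteq> arcs D"
  shows "cmod (holonomy \<rho> p) = 1"
  using assms by (induction p) (auto simp: holonomy_eq_prod_edges norm_mult cmod_edge_holonomy)

text \<open>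
  The determinant is evaluated for one particular matching \<open>F\<close> of vertices with oriented edges: a vertex
  on a chosen circuit takes the edge on which the circuit leaves it, any other vertex an edge that leads
  closer to the circuits.
\<close>

lemma rho_hat_eq_det_ex:
  assumes H1: "H1 G \<rho> = {\<lambda>_. 0}" and B0: "B0 G \<rho> = C0 G"
  shows "\<exists>f. bij_betw f (verts G) (arcs G) \<and>
    rho_hat \<rho> G = of_real ((cmod (det_on (verts G) (\<lambda>v. edge_bdry G \<rho> (f v))))\<^sup>2)"
proof -
  let ?V = "verts G" and ?\<K> = "components G"
  define P where "P K = (SOME p. oriented_circuit K p)" for K :: "('v,'e) pre_digraph"
  have P: "oriented_circuit K (P K)" if "K \<in> ?\<K>" for K
    unfolding P_def using component_has_circuit[OF B0 that] by (rule someI_ex)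
  note circ = circuit_properties[OF component_subgraph P]
  have ends: "tail (oriented_double K) = tail D" "head (oriented_double K) = head D" if "K \<in> ?\<K>" for K
    using oriented_double_subgraph_ends[OF component_subgraph[OF that]] .
  have in_K: "fst e \<in> arcs K" "e \<in> arcs D" "tail D e \<in> verts K" "head D e \<in> verts K"
    if "K \<in> ?\<K>" "e \<in> set (P K)" for K e
  proof -
    have e: "e \<in> arcs (oriented_double K)" using circ(2)[OF that(1,1)] that(2) by auto
    have "wf_digraph K" "arcs K \<subseteq> arcs G" using component_subgraph[OF that(1)] by auto
    then interpret K: wf_digraph "oriented_double K" using wf_digraph.wf_oriented_double by blast
    show "fst e \<in> arcs K" "e \<in> arcs D" "tail D e \<in> verts K" "head D e \<in> verts K"
      using e K.tail_in_verts[OF e] K.head_in_verts[OF e] ends[OF that(1)] \<open>arcs K \<subseteq> arcs G\<close>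
      by (auto simp: arcs_oriented_double)
  qed
  have same: "K = K'" if "K \<in> ?\<K>" "K' \<in> ?\<K>" "v \<in> verts K" "v \<in> verts K'" for K K' v
    using that components_eq_component_of by metis
  \<comment> \<open>circuits of different components share neither vertices nor edges, so an element of \<open>Es\<close> is determined by
  its tail and also by its underlying edge\<close>
  define Es where "Es = (\<Union>K\<in>?\<K>. set (P K))"
  define R where "R = tail D ` Es"
  have inj_tail: "inj_on (tail D) Es"
  proof (rule inj_onI)
    fix e e' assume *: "e \<in> Es" "e' \<in> Es" "tail D e = tail D e'"
    then obtain K K' where K: "K \<in> ?\<K>" "e \<in> set (P K)" "K' \<in> ?\<K>" "e' \<in> set (P K')" by (auto simp: Es_def)
    then have "K = K'" using same in_K(3) * by metis
    then show "e = e'" using circ(3)[of K] K * by (auto simp: distinct_map inj_on_def)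
  qed
  have inj_fst: "inj_on fst Es"
  proof (rule inj_onI)
    fix e e' assume *: "e \<in> Es" "e' \<in> Es" "fst e = fst e'"
    then obtain K K' where K: "K \<in> ?\<K>" "e \<in> set (P K)" "K' \<in> ?\<K>" "e' \<in> set (P K')" by (auto simp: Es_def)
    have "tail D e \<in> {tail D e', head D e'}" using * by (auto simp: oriented_double_simps)
    then have "K = K'" using same[OF K(1,3)] in_K(3)[OF K(1,2)] in_K(3,4)[OF K(3,4)] by auto
    then show "e = e'" using circ(4)[of K] K * by (auto simp: distinct_map inj_on_def)
  qed
  have "\<exists>r\<in>R. v \<rightarrow>\<^sup>*\<^bsub>D\<^esub> r" if v: "v \<in> verts D" for v
  proof -
    have K: "component_of v \<in> ?\<K>" using v component_of_in_components by simp
    then have "hd (P (component_of v)) \<in> set (P (component_of v))" using circ(1)[OF K K] by simp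
    from in_K(3)[OF K this] this K show ?thesis
      by (auto simp: R_def Es_def component_of_def)
  qed
  then obtain dist :: "'v \<Rightarrow> nat" and F0 where "\<And>v. v \<in> verts D - R \<Longrightarrow>
      F0 v \<in> arcs D \<and> tail D (F0 v) = v \<and> dist (head D (F0 v)) < dist v"
    by (rule D.descending_arcs[of R]) blast+
  then have F0: "\<And>v. v \<in> ?V - R \<Longrightarrow> F0 v \<in> arcs D \<and> tail D (F0 v) = v \<and> dist (head D (F0 v)) < dist v"
    by simp
  define F where "F v = (if v \<in> R then the_inv_into Es (tail D) v else F0 v)" for v
  have FO: "F (tail D e) = e" if "e \<in> Es" for e
    using that by (simp add: F_def R_def the_inv_into_f_f[OF inj_tail])
  have F: "F v \<in> arcs D" "tail D (F v) = v" if "v \<in> ?V" for v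
  proof -
    have "F v \<in> arcs D \<and> tail D (F v) = v"
    proof (cases "v \<in> R")
      case True
      then obtain e where "e \<in> Es" "v = tail D e" by (auto simp: R_def)
      moreover from this have "e \<in> arcs D" using in_K(2) unfolding Es_def by blast
      ultimately show ?thesis using FO by simp
    next
      case False
      then show ?thesis using F0[of v] that by (simp add: F_def)
    qed
    then show "F v \<in> arcs D" "tail D (F v) = v" by auto
  qed
  have headR: "head D e \<in> R" if "e \<in> Es" for e
  proof -
    obtain K where K: "K \<in> ?\<K>" "e \<in> set (P K)" using \<open>e \<in> Es\<close> by (auto simp: Es_def)
    obtain i where i: "i < length (P K)" "e = P K ! i" using K(2) by (metis in_set_conv_nth)
    have "\<exists>e'\<in>set (P K). head D e = tail D e'"
    proof (cases "Suc i < length (P K)")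
      case True
      then show ?thesis using circ(6)[OF K(1,1) True] i by (intro bexI[of _ "P K ! Suc i"]) auto
    next
      case False
      then have "i = length (P K) - 1" using i by simp
      then have "e = last (P K)" using i circ(1)[OF K(1,1)] by (simp add: last_conv_nth)
      then show ?thesis using circ(1,5)[OF K(1,1)] by (intro bexI[of _ "hd (P K)"]) auto
    qed
    then show ?thesis using K(1) by (auto simp: R_def Es_def)
  qed
  have inj_F: "inj_on (\<lambda>v. fst (F v)) ?V"
  proof (rule inj_onI)
    fix v w assume vw: "v \<in> ?V" "w \<in> ?V" "fst (F v) = fst (F w)"
    have mixed: False if m: "v \<in> ?V" "v \<notin> R" "w \<in> R" "fst (F v) = fst (F w)" for v w
    proof -
      obtain e where e: "e \<in> Es" "w = tail D e" using m(3) by (auto simp: R_def)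
      have "tail D (F v) \<in> {tail D e, head D e}"
        using m(4) FO[OF e(1)] e(2) by (auto simp: oriented_double_simps)
      then show False using F(2)[OF m(1)] m(2) headR[OF e(1)] e by (auto simp: R_def)
    qed
    show "v = w"
    proof (cases "v \<in> R"; cases "w \<in> R")
      assume "v \<in> R" "w \<in> R"
      then obtain e e' where "e \<in> Es" "v = tail D e" "e' \<in> Es" "w = tail D e'" by (auto simp: R_def)
      then show ?thesis using FO vw(3) inj_fst by (metis inj_on_def)
    next
      assume *: "v \<notin> R" "w \<notin> R"
      have "inj_on (\<lambda>v. fst (F0 v)) (?V - R)"
        by (rule descending_edges_inj[where dist=dist and G=G]) (use F0 in blast)
      then show ?thesis using * vw by (simp add: inj_on_def F_def)
    qed (use mixed vw in metis)+
  qed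
  have fst_F: "fst (F v) \<in> arcs G" if "v \<in> ?V" for v
    using F(1)[OF that] by (simp add: arcs_oriented_double mem_Times_iff)
  \<comment> \<open>injectivity suffices, since there are no more edges than vertices\<close>
  have imF: "(\<lambda>v. fst (F v)) ` ?V = arcs G"
  proof (rule card_subset_eq)
    show "(\<lambda>v. fst (F v)) ` ?V \<subseteq> arcs G" using fst_F by auto
    then show "card ((\<lambda>v. fst (F v)) ` ?V) = card (arcs G)"
      using card_arcs_le_card_verts[OF H1] card_image[OF inj_F] card_mono[OF finite_arcs, of "(\<lambda>v. fst (F v)) ` ?V"]
      by linarith
  qed simp

  define x where "x v = (\<lambda>z. single v z - inverse (edge_holonomy \<rho> (F v)) * single (head D (F v)) z)" for v
  define U where "U \<L> = (?V - R) \<union> (\<Union>K\<in>\<L>. tail D ` set (P K))" for \<L>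
  \<comment> \<open>start with the rows off the circuits, and put in the circuits one at a time\<close>
  have partial: "det_on ?V (\<lambda>v. if v \<in> U \<L> then x v else single v) = (\<Prod>K\<in>\<L>. 1 - inverse (holonomy \<rho> (P K)))"
    if "finite \<L>" "\<L> \<subseteq> ?\<K>" for \<L>
    using that
  proof (induction \<L> rule: finite_induct)
    case empty
    have "det_on ?V (\<lambda>v. if v \<in> ?V - R then
        (\<lambda>z. single v z - inverse (edge_holonomy \<rho> (F v)) * single (head D (F v)) z) else single v) = 1"
    proof (rule det_on_forest)
      fix v assume v: "v \<in> ?V - R"
      have "head D (F v) \<in> ?V" using F(1)[of v] v D.head_in_verts by fastforce
      then show "head D (F v) \<in> ?V \<and> (head D (F v) \<in> ?V - R \<longrightarrow> dist (head D (F v)) < dist v)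
          \<and> head D (F v) \<noteq> v"
        using F0[OF v] v by (auto simp: F_def)
    qed auto
    then show ?case by (simp add: U_def x_def cong: if_cong)
  next
    case (insert K \<L>)
    have K: "K \<in> ?\<K>" using insert by simp
    have "det_on ?V (\<lambda>v. if v \<in> U (insert K \<L>) then x v else single v) =
        (1 - inverse (holonomy \<rho> (P K))) * det_on ?V (\<lambda>v. if v \<in> U \<L> then x v else single v)"
    proof (rule det_on_circuit[OF component_subgraph[OF K] P[OF K]])
      fix v assume "v \<in> tail D ` set (P K)"
      then obtain e where e: "e \<in> set (P K)" "v = tail D e" by auto
      have "v \<notin> tail D ` set (P K')" if "K' \<in> \<L>" for K'
        using same[OF K, of K' v] in_K(3)[OF K e(1)] in_K(3)[of K'] that insert e by auto
      moreover have "v \<in> R" using e K by (auto simp: R_def Es_def)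
      ultimately show "(if v \<in> U \<L> then x v else single v) = single v" by (auto simp: U_def)
    next
      fix v assume "v \<notin> tail D ` set (P K)"
      then show "(if v \<in> U (insert K \<L>) then x v else single v) = (if v \<in> U \<L> then x v else single v)"
        by (auto simp: U_def)
    next
      fix e assume e: "e \<in> set (P K)"
      then have "e \<in> Es" using K by (auto simp: Es_def)
      then show "(if tail D e \<in> U (insert K \<L>) then x (tail D e) else single (tail D e)) =
          (\<lambda>z. single (tail D e) z - inverse (edge_holonomy \<rho> e) * single (head D e) z)"
        using e by (auto simp: U_def x_def FO)
    qed
    then show ?case using insert by simp
  qed
  have "U ?\<K> \<supseteq> ?V" by (auto simp: U_def R_def Es_def)
  then have "det_on ?V x = det_on ?V (\<lambda>v. if v \<in> U ?\<K> then x v else single v)"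
    by (intro det_on_cong) auto
  then have det_x: "det_on ?V x = (\<Prod>K\<in>?\<K>. 1 - inverse (holonomy \<rho> (P K)))"
    using partial[OF finite_components] by simp

  have "det_on ?V (\<lambda>v. edge_bdry G \<rho> (fst (F v))) = det_on ?V (\<lambda>v z. tail_coeff \<rho> (F v) * x v z)"
  proof (rule det_on_cong)
    fix v assume v: "v \<in> ?V"
    have "\<rho> (fst (F v)) \<noteq> 0" using fst_F[OF v] by (rule rho_nonzero)
    from edge_bdry_oriented[where \<rho>=\<rho> and e="F v" and G=G, OF this] show "edge_bdry G \<rho> (fst (F v)) = (\<lambda>z. tail_coeff \<rho> (F v) * x v z)"
      by (simp add: x_def F(2)[OF v])
  qed
  also have "\<dots> = (\<Prod>v\<in>?V. tail_coeff \<rho> (F v)) * det_on ?V x" by (rule det_on_scale_rows) simp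
  finally have "cmod (det_on ?V (\<lambda>v. edge_bdry G \<rho> (fst (F v)))) = cmod (det_on ?V x)"
    by (simp add: norm_mult prod_norm[symmetric] cmod_tail_coeff F(1))
  moreover have "rho_hat \<rho> G = of_real ((cmod (det_on ?V x))\<^sup>2)"
  proof -
    have "(holonomy \<rho> (P K) - 1) * (cnj (holonomy \<rho> (P K)) - 1)
        = of_real ((cmod (1 - inverse (holonomy \<rho> (P K))))\<^sup>2)" if K: "K \<in> ?\<K>" for K
    proof -
      let ?z = "holonomy \<rho> (P K)"
      have "cmod ?z = 1" using in_K(2)[OF K] by (intro cmod_holonomy) auto
      then have "inverse ?z = cnj ?z"
        by (metis complex_norm_square inverse_unique of_real_1 one_power2)
      then show ?thesis by (simp only: complex_norm_square) (simp add: algebra_simps)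
    qed
    then show ?thesis
      unfolding rho_hat_def Let_def P_def[symmetric] det_x
      by (simp add: prod_norm[symmetric] prod_power_distrib)
  qed
  moreover have "bij_betw (\<lambda>v. fst (F v)) ?V (arcs G)" using inj_F imF by (simp add: bij_betw_def)
  ultimately show ?thesis by (intro exI[of _ "\<lambda>v. fst (F v)"]) simp
qed

lemma rho_hat_eq_det:
  assumes "H1 G \<rho> = {\<lambda>_. 0}" "B0 G \<rho> = C0 G" "bij_betw f (verts G) (arcs G)"
  shows "rho_hat \<rho> G = of_real ((cmod (det_on (verts G) (\<lambda>v. edge_bdry G \<rho> (f v))))\<^sup>2)"
proof -
  obtain g where g: "bij_betw g (verts G) (arcs G)"
    "rho_hat \<rho> G = of_real ((cmod (det_on (verts G) (\<lambda>v. edge_bdry G \<rho> (g v))))\<^sup>2)"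
    using rho_hat_eq_det_ex[OF assms(1,2)] by blast
  show ?thesis
    unfolding g(2) cmod_det_on_bij[where a="edge_bdry G \<rho>", OF finite_verts assms(3) g(1)] by (rule refl)
qed

lemma rho_hat_pos:
  assumes H1: "H1 G \<rho> = {\<lambda>_. 0}" and B0: "B0 G \<rho> = C0 G"
  shows "\<exists>t>0. rho_hat \<rho> G = of_real t"
proof -
  have "\<exists>t>0. (holonomy \<rho> p - 1) * (cnj (holonomy \<rho> p) - 1) = of_real t"
    if "K \<in> components G" "oriented_circuit K p" for K p
  proof -
    have "holonomy \<rho> p \<noteq> 1"
      using oriented_circuit_holonomy[OF H1 oriented_circuit_subgraph[OF component_subgraph[OF that(1)] that(2)]] .
    moreover have "(holonomy \<rho> p - 1) * (cnj (holonomy \<rho> p) - 1) = of_real ((cmod (holonomy \<rho> p - 1))\<^sup>2)"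
      by (simp only: complex_norm_square) simp
    ultimately show ?thesis by (intro exI[of _ "(cmod (holonomy \<rho> p - 1))\<^sup>2"]) auto
  qed
  moreover have "oriented_circuit K (SOME p. oriented_circuit K p)" if "K \<in> components G" for K
    using component_has_circuit[OF B0 that] by (rule someI_ex)
  ultimately have "\<forall>K\<in>components G. \<exists>t>0. (let z = holonomy \<rho> (SOME p. oriented_circuit K p)
      in (z - 1) * (cnj z - 1)) = of_real t"
    unfolding Let_def by blast
  then obtain t where t: "\<And>K. K \<in> components G \<Longrightarrow> t K > 0 \<and> (let z = holonomy \<rho> (SOME p. oriented_circuit K p)
      in (z - 1) * (cnj z - 1)) = of_real (t K)" by metis
  then have "rho_hat \<rho> G = of_real (\<Prod>K\<in>components G. t K)" unfolding rho_hat_def by simp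
  moreover have "(\<Prod>K\<in>components G. t K) > 0" using t by (simp add: prod_pos)
  ultimately show ?thesis by blast
qed

end

section \<open>Twisted spanning trees\<close>

context twisted_graph
begin

lemma H1_combination:
  assumes "\<And>i. i \<in> I \<Longrightarrow> f i \<in> H1 G \<rho>"
  shows "(\<lambda>e. \<Sum>i\<in>I. k i * f i e) \<in> H1 G \<rho>"
proof -
  have "bdry G \<rho> (\<lambda>e. \<Sum>i\<in>I. k i * f i e) = (\<lambda>v. \<Sum>i\<in>I. k i * bdry G \<rho> (f i) v)"
    unfolding bdry_eq_edge_bdry sum_distrib_left sum_distrib_right
    by (subst sum.swap) (simp add: mult.assoc)
  then show ?thesis using assms by (auto simp: H1_def C1_def intro!: sum.neutral)
qed

lemma bdry_diff_scale: "bdry G \<rho> (\<lambda>e. c e - k * d e) = (\<lambda>v. bdry G \<rho> c v - k * bdry G \<rho> d v)"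
  by (simp add: bdry_eq_edge_bdry left_diff_distrib sum_subtractf sum_distrib_left mult.assoc)

lemma H1_diff_scale:
  assumes "c \<in> H1 G \<rho>" "d \<in> H1 G \<rho>"
  shows "(\<lambda>e. c e - k * d e) \<in> H1 G \<rho>"
  using assms by (auto simp: H1_def C1_def bdry_diff_scale fun_eq_iff)

lemma H0_eq_if_boundaries:
  assumes "B0 G \<rho> = C0 G"
  shows "H0 G \<rho> = {C0 G}"
proof -
  have "homologous G \<rho> `` {x} = C0 G" if "x \<in> C0 G" for x
    using that by (auto simp: homologous_def assms C0_def)
  moreover have "(\<lambda>_. 0) \<in> C0 G" by (simp add: C0_def)
  ultimately show ?thesis unfolding H0_def quotient_def by blast
qed

lemma B0_uminus:
  assumes "(\<lambda>_. 0) - x \<in> B0 G \<rho>"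
  shows "x \<in> B0 G \<rho>"
proof -
  obtain c where c: "c \<in> C1 G" "(\<lambda>_. 0) - x = bdry G \<rho> c" using assms by (auto simp: B0_def)
  have "x v = - bdry G \<rho> c v" for v
    using arg_cong[OF fun_cong[OF c(2), of v], of uminus] by simp
  then have "x = bdry G \<rho> (\<lambda>b. - c b)"
    by (simp add: bdry_eq_edge_bdry fun_eq_iff sum_negf)
  moreover have "(\<lambda>b. - c b) \<in> C1 G" using c(1) by (auto simp: C1_def)
  ultimately show ?thesis by (auto simp: B0_def)
qed

lemma boundaries_if_H0_singleton:
  assumes "H0 G \<rho> = {A}"
  shows "B0 G \<rho> = C0 G"
proof
  show "B0 G \<rho> \<subseteq> C0 G" using bdry_in_C0 by (auto simp: B0_def)
  show "C0 G \<subseteq> B0 G \<rho>"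
  proof
    fix x assume x: "x \<in> C0 G"
    have zero: "(\<lambda>_. 0) \<in> C0 G" by (simp add: C0_def)
    have cls: "homologous G \<rho> `` {y} = A" if "y \<in> C0 G" for y
      using assms quotientI[OF that, of "homologous G \<rho>"] by (simp add: H0_def)
    have "bdry G \<rho> (\<lambda>_. 0) \<in> B0 G \<rho>" unfolding B0_def by (rule imageI) (simp add: C1_def)
    also have "bdry G \<rho> (\<lambda>_. 0) = x - x" by (simp add: bdry_eq_edge_bdry fun_eq_iff)
    finally have "x - x \<in> B0 G \<rho>" .
    then have "x \<in> homologous G \<rho> `` {x}" using x by (simp add: homologous_def)
    also have "\<dots> = homologous G \<rho> `` {\<lambda>_. 0}" using cls[OF x] cls[OF zero] by simp
    finally have "(\<lambda>_. 0) - x \<in> B0 G \<rho>" unfolding homologous_def by blast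
    then show "x \<in> B0 G \<rho>" by (rule B0_uminus)
  qed
qed

end

text \<open>
  The hypothesis on \<open>B0\<close> is that \<open>H0\<close> vanishes. In this form it can be
  compared with the same condition on spanning subgraphs.
\<close>

locale resistor_network = twisted_graph +
  fixes r :: "'b \<Rightarrow> real"
  assumes boundaries: "B0 G \<rho> = C0 G" and resistance_pos: "b \<in> arcs G \<Longrightarrow> r b > 0"
begin

lemma spanning_twisted_graph:
  assumes "spanning T G"
  shows "twisted_graph T \<rho>" "tail T = tail G" "head T = head G" "verts T = verts G" "arcs T \<subseteq> arcs G"
proof -
  have sub: "subgraph T G" using assms by (simp add: spanning_def)
  interpret T: fin_digraph T using fin_digraph_subgraph[OF sub] .
  show "arcs T \<subseteq> arcs G" using sub by auto
  then show "twisted_graph T \<rho>" using unitary by unfold_locales auto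
  show "tail T = tail G" "head T = head G" using sub by (auto simp: subgraph_def compatible_def)
  show "verts T = verts G" using assms by (simp add: spanning_def)
qed

lemma spanning_update_arcs:
  assumes "spanning T G" "S \<subseteq> arcs G"
  shows "spanning (T\<lparr>arcs := S\<rparr>) G"
proof -
  note T = spanning_twisted_graph[OF assms(1)]
  have "wf_digraph (T\<lparr>arcs := S\<rparr>)"
    using assms(2) T by unfold_locales auto
  then show ?thesis
    using assms(2) T by (auto simp: spanning_def subgraph_def compatible_def wf_digraph)
qed

lemma spanning_bdry:
  assumes "spanning T G" "c \<in> C1 T"
  shows "bdry T \<rho> c = bdry G \<rho> c"
proof -
  note T = spanning_twisted_graph[OF assms(1)]
  have "(\<Sum>b\<in>arcs T. c b * edge_bdry T \<rho> b v) = (\<Sum>b\<in>arcs G. c b * edge_bdry G \<rho> b v)" for v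
    using assms(2) T(2,3,5) by (intro sum.mono_neutral_cong_left) (auto simp: C1_def edge_bdry_def)
  then show ?thesis by (simp add: bdry_eq_edge_bdry)
qed

lemma spanning_C0: "spanning T G \<Longrightarrow> C0 T = C0 G"
  by (simp add: C0_def spanning_def)

lemma spanning_H1_iff:
  assumes "spanning T G"
  shows "c \<in> H1 T \<rho> \<longleftrightarrow> c \<in> H1 G \<rho> \<and> (\<forall>e. e \<notin> arcs T \<longrightarrow> c e = 0)"
proof -
  have "c \<in> C1 G" if "c \<in> C1 T" using that spanning_twisted_graph(5)[OF assms] by (auto simp: C1_def)
  then show ?thesis using spanning_bdry[OF assms] by (auto simp: H1_def C1_def)
qed

text \<open>
  As \<open>H0\<close> of the whole graph is zero, the isomorphism in the definition of a tree says that \<open>H0\<close> of the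
  tree is zero too. A tree is thus a set of edges whose boundaries form a basis of the 0-chains.
\<close>

lemma rho_spanning_tree_iff:
  "rho_spanning_tree G \<rho> T \<longleftrightarrow> spanning T G \<and> H1 T \<rho> = {\<lambda>_. 0} \<and> B0 T \<rho> = C0 G"
proof -
  have "bij_betw (H0_incl G \<rho>) (H0 T \<rho>) (H0 G \<rho>) \<longleftrightarrow> B0 T \<rho> = C0 G" if T: "spanning T G"
  proof
    interpret T: twisted_graph T \<rho> using spanning_twisted_graph[OF T] by simp
    assume "bij_betw (H0_incl G \<rho>) (H0 T \<rho>) (H0 G \<rho>)"
    then have "card (H0 T \<rho>) = 1"
      using H0_eq_if_boundaries[OF boundaries] bij_betw_same_card by fastforce
    then obtain A where "H0 T \<rho> = {A}" by (auto simp: card_1_singleton_iff)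
    then show "B0 T \<rho> = C0 G" using T.boundaries_if_H0_singleton spanning_C0[OF T] by simp
  next
    interpret T: twisted_graph T \<rho> using spanning_twisted_graph[OF T] by simp
    assume "B0 T \<rho> = C0 G"
    then have "H0 T \<rho> = {C0 G}" using T.H0_eq_if_boundaries spanning_C0[OF T] by simp
    moreover have "H0_incl G \<rho> (C0 G) = C0 G"
    proof -
      have "homologous G \<rho> = C0 G \<times> C0 G" by (auto simp: homologous_def boundaries C0_def)
      moreover have "(\<lambda>_. 0) \<in> C0 G" by (simp add: C0_def)
      ultimately show ?thesis by (auto simp: H0_incl_def)
    qed
    ultimately show "bij_betw (H0_incl G \<rho>) (H0 T \<rho>) (H0 G \<rho>)"
      by (simp add: H0_eq_if_boundaries[OF boundaries] bij_betw_def)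
  qed
  then show ?thesis by (auto simp: rho_spanning_tree_def)
qed

lemma tree_properties:
  assumes "rho_spanning_tree G \<rho> T"
  shows "spanning T G" "twisted_graph T \<rho>" "tail T = tail G" "head T = head G" "verts T = verts G"
    "arcs T \<subseteq> arcs G" "H1 T \<rho> = {\<lambda>_. 0}" "B0 T \<rho> = C0 T"
  using assms spanning_twisted_graph[of T] spanning_C0[of T] by (auto simp: rho_spanning_tree_iff)

lemma tree_cycle_zero:
  assumes "rho_spanning_tree G \<rho> T" "c \<in> H1 G \<rho>" "\<And>e. e \<notin> arcs T \<Longrightarrow> c e = 0"
  shows "c = (\<lambda>_. 0)"
  using assms spanning_H1_iff[of T c] by (auto simp: rho_spanning_tree_iff)

lemma tree_boundary:
  assumes "rho_spanning_tree G \<rho> T" "x \<in> C0 G"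
  obtains c where "\<And>e. e \<notin> arcs T \<Longrightarrow> c e = 0" "bdry G \<rho> c = x"
proof -
  have "x \<in> B0 T \<rho>" using assms by (simp add: rho_spanning_tree_iff)
  then obtain c where "c \<in> C1 T" "x = bdry T \<rho> c" by (auto simp: B0_def)
  then show ?thesis using spanning_bdry[OF tree_properties(1)[OF assms(1)]] that by (auto simp: C1_def)
qed

lemma spanning_B0_eq_C0I:
  assumes T: "spanning T G"
    and "\<And>x. x \<in> C0 G \<Longrightarrow> \<exists>c. (\<forall>e. e \<notin> arcs T \<longrightarrow> c e = 0) \<and> bdry G \<rho> c = x"
  shows "B0 T \<rho> = C0 G"
proof
  interpret T: twisted_graph T \<rho> using spanning_twisted_graph[OF T] by simp
  show "B0 T \<rho> \<subseteq> C0 G" using T.bdry_in_C0 spanning_C0[OF T] by (auto simp: B0_def)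
  show "C0 G \<subseteq> B0 T \<rho>"
  proof
    fix x assume "x \<in> C0 G"
    then obtain c where c: "\<And>e. e \<notin> arcs T \<Longrightarrow> c e = 0" "bdry G \<rho> c = x" using assms(2) by blast
    then have "c \<in> C1 T" by (simp add: C1_def)
    then show "x \<in> B0 T \<rho>" using spanning_bdry[OF T] c(2) unfolding B0_def by (intro image_eqI[of _ _ c]) auto
  qed
qed

lemma finite_trees: "finite {T. rho_spanning_tree G \<rho> T}"
proof (rule finite_subset)
  show "{T. rho_spanning_tree G \<rho> T} \<subseteq> (\<lambda>S. G\<lparr>arcs := S\<rparr>) ` Pow (arcs G)"
  proof clarify
    fix T assume "rho_spanning_tree G \<rho> T"
    note T = tree_properties[OF this]
    have "T = G\<lparr>arcs := arcs T\<rparr>" using T by (intro pre_digraph.equality) auto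
    then show "T \<in> (\<lambda>S. G\<lparr>arcs := S\<rparr>) ` Pow (arcs G)" using T(6) by blast
  qed
qed simp

text \<open>
  The boundaries of the edges span the 0-chains; a smallest spanning set of edges is a basis, because an edge
  on which a cycle does not vanish could be dropped.
\<close>

lemma ex_tree: "\<exists>T. rho_spanning_tree G \<rho> T"
proof -
  define \<S> where "\<S> = {S. S \<subseteq> arcs G \<and> B0 (G\<lparr>arcs := S\<rparr>) \<rho> = C0 G}"
  have spG: "spanning G G" by (simp add: spanning_def subgraph_refl)
  have "arcs G \<in> \<S>" using boundaries by (simp add: \<S>_def)
  moreover have "finite \<S>" unfolding \<S>_def by (rule finite_subset[of _ "Pow (arcs G)"]) auto
  ultimately obtain S where S: "S \<in> \<S>" "\<And>S'. S' \<in> \<S> \<Longrightarrow> card S \<le> card S'"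
    using ex_min_if_finite[of "card ` \<S>"] arg_min_if_finite[of \<S> card]
    by (metis empty_iff not_le)
  let ?T = "G\<lparr>arcs := S\<rparr>"
  have SG: "S \<subseteq> arcs G" "finite S" using S(1) finite_subset[OF _ finite_arcs] by (auto simp: \<S>_def)
  have T: "spanning ?T G" using spanning_update_arcs[OF spG SG(1)] .
  have "c = (\<lambda>_. 0)" if c: "c \<in> H1 ?T \<rho>" for c
  proof (rule ccontr)
    assume "c \<noteq> (\<lambda>_. 0)"
    then obtain b where b: "c b \<noteq> 0" by (auto simp: fun_eq_iff)
    have cG: "c \<in> H1 G \<rho>" "\<And>e. e \<notin> S \<Longrightarrow> c e = 0" using c spanning_H1_iff[OF T] by auto
    have bS: "b \<in> S" using b cG by blast
    have T': "spanning (G\<lparr>arcs := S - {b}\<rparr>) G" using SG by (intro spanning_update_arcs[OF spG]) auto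
    have "B0 (G\<lparr>arcs := S - {b}\<rparr>) \<rho> = C0 G"
    proof (rule spanning_B0_eq_C0I[OF T'])
      fix x assume "x \<in> C0 G"
      then have "x \<in> B0 ?T \<rho>" using S(1) by (simp add: \<S>_def)
      then obtain d where d: "d \<in> C1 ?T" "x = bdry ?T \<rho> d" by (auto simp: B0_def)
      define d' where "d' = (\<lambda>e. d e - (d b / c b) * c e)"
      have "bdry G \<rho> d' = x"
        unfolding d'_def bdry_diff_scale using cG(1) d spanning_bdry[OF T d(1)] by (simp add: H1_def)
      moreover have "d' e = 0" if "e \<notin> arcs (G\<lparr>arcs := S - {b}\<rparr>)" for e
      proof (cases "e = b")
        case True
        then show ?thesis using b by (simp add: d'_def)
      next
        case False
        then show ?thesis using that cG(2)[of e] d(1) by (simp add: d'_def C1_def)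
      qed
      ultimately show "\<exists>c. (\<forall>e. e \<notin> arcs (G\<lparr>arcs := S - {b}\<rparr>) \<longrightarrow> c e = 0) \<and> bdry G \<rho> c = x"
        by blast
    qed
    then have "S - {b} \<in> \<S>" using SG(1) unfolding \<S>_def by blast
    from S(2)[OF this] card_Diff1_less[OF SG(2) bS] show False by simp
  qed
  moreover have "(\<lambda>_. 0) \<in> H1 ?T \<rho>" by (simp add: H1_def C1_def bdry_eq_edge_bdry)
  ultimately have "H1 ?T \<rho> = {\<lambda>_. 0}" by blast
  then have "rho_spanning_tree G \<rho> ?T" using T S(1) by (auto simp: rho_spanning_tree_iff \<S>_def)
  then show ?thesis by blast
qed

lemma tree_weight_pos:
  assumes "rho_spanning_tree G \<rho> T"
  shows "\<exists>t>0. tree_weight \<rho> r T = of_real t"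
proof -
  note T = tree_properties[OF assms]
  obtain s where s: "s > 0" "rho_hat \<rho> T = of_real s"
    using twisted_graph.rho_hat_pos[OF T(2,7,8)] by blast
  have "tree_weight \<rho> r T = of_real (s * (\<Prod>b\<in>arcs T. inverse (r b)))"
    by (simp add: tree_weight_def s(2))
  moreover have "s * (\<Prod>b\<in>arcs T. inverse (r b)) > 0"
    using s(1) T(6) resistance_pos by (intro mult_pos_pos prod_pos) auto
  ultimately show ?thesis by blast
qed

lemma total_weight_pos: "\<exists>t>0. total_weight G \<rho> r = of_real t"
proof -
  obtain t where t: "\<And>T. rho_spanning_tree G \<rho> T \<Longrightarrow> t T > 0 \<and> tree_weight \<rho> r T = of_real (t T)"
    using tree_weight_pos by metis
  then have "total_weight G \<rho> r = of_real (\<Sum>T | rho_spanning_tree G \<rho> T. t T)"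
    by (simp add: total_weight_def)
  moreover have "(\<Sum>T | rho_spanning_tree G \<rho> T. t T) > 0"
    using t ex_tree finite_trees by (intro sum_pos) auto
  ultimately show ?thesis by blast
qed

section \<open>Fundamental cycles\<close>

text \<open>
  Two chains with these properties differ by a cycle supported on \<open>T\<close>. For the same reason the cycle picked
  in the definition of \<open>T_bar_edge\<close> is a multiple of \<open>z\<close>.
\<close>

lemma T_bar_edge_unique:
  assumes T: "rho_spanning_tree G \<rho> T" and b: "b \<in> arcs G" "b \<notin> arcs T"
    and z: "z \<in> H1 G \<rho>" "z b = 1" "\<And>e. e \<notin> insert b (arcs T) \<Longrightarrow> z e = 0"
  shows "T_bar_edge G \<rho> T b = z"
proof -
  note t = tree_properties[OF T]
  let ?A = "pre_digraph.add_arc T b"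
  have "?A = T\<lparr>arcs := insert b (arcs T)\<rparr>"
    using b(1) t by (intro pre_digraph.equality) (auto simp: pre_digraph.verts_add_arc_conv pre_digraph.add_arc_simps)
  then have A: "spanning ?A G" "arcs ?A = insert b (arcs T)"
    using spanning_update_arcs[OF t(1), of "insert b (arcs T)"] t(6) b(1) by auto
  define c where "c = (SOME c. c \<in> H1 ?A \<rho> \<and> c \<noteq> (\<lambda>_. 0))"
  have "z \<in> H1 ?A \<rho> \<and> z \<noteq> (\<lambda>_. 0)"
    using z spanning_H1_iff[OF A(1)] A(2) by (auto simp: fun_eq_iff intro!: exI[of _ b])
  then have "c \<in> H1 ?A \<rho> \<and> c \<noteq> (\<lambda>_. 0)" unfolding c_def by (rule someI[where P="\<lambda>c. c \<in> H1 ?A \<rho> \<and> c \<noteq> (\<lambda>_. 0)"])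
  then have c: "c \<in> H1 G \<rho>" "\<And>e. e \<notin> insert b (arcs T) \<Longrightarrow> c e = 0" "c \<noteq> (\<lambda>_. 0)"
    using spanning_H1_iff[OF A(1)] A(2) by auto
  have cz: "(\<lambda>e. c e - c b * z e) = (\<lambda>_. 0)"
  proof (rule tree_cycle_zero[OF T H1_diff_scale[OF c(1) z(1)]])
    show "c e - c b * z e = 0" if "e \<notin> arcs T" for e
      using that c(2)[of e] z(2) z(3)[of e] by (cases "e = b") auto
  qed
  have cz': "c e = c b * z e" for e using fun_cong[OF cz, of e] by simp
  then have "c b \<noteq> 0" using c(3) by (metis mult_zero_left)
  moreover have "inner_std G c (single b) = c b"
    using b(1) by (simp add: inner_R_def single_def if_distrib[of cnj] if_distrib[of "\<lambda>x. _ * x"] sum.delta cong: if_cong)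
  ultimately show ?thesis
    using b(2) nonzero_mult_div_cancel_left[of "c b"]
    unfolding T_bar_edge_def Let_def c_def[symmetric] by (subst cz') simp
qed

text \<open>
  The boundary of \<open>b\<close> is also the boundary of a chain of the tree; subtracting that chain from \<open>b\<close> gives the cycle.
\<close>

lemma T_bar_edge_props:
  assumes T: "rho_spanning_tree G \<rho> T" and b: "b \<in> arcs G" "b \<notin> arcs T"
  shows "T_bar_edge G \<rho> T b \<in> H1 G \<rho>" "T_bar_edge G \<rho> T b b = 1"
    "\<And>e. e \<notin> insert b (arcs T) \<Longrightarrow> T_bar_edge G \<rho> T b e = 0"
proof -
  have "edge_bdry G \<rho> b \<in> C0 G" using edge_bdry_outside[OF b(1)] by (auto simp: C0_def)
  then obtain c where c: "\<And>e. e \<notin> arcs T \<Longrightarrow> c e = 0" "bdry G \<rho> c = edge_bdry G \<rho> b"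
    using tree_boundary[OF T] by metis
  define z where "z = (\<lambda>e. single b e - 1 * c e)"
  have "bdry G \<rho> (single b) = edge_bdry G \<rho> b"
    using b(1) by (simp add: bdry_eq_edge_bdry single_def if_distrib[of "\<lambda>x. x * _"] sum.delta cong: if_cong)
  then have "bdry G \<rho> z = (\<lambda>_. 0)" unfolding z_def by (simp only: bdry_diff_scale c(2)) simp
  moreover have "z \<in> C1 G" using c(1) b tree_properties(6)[OF T] by (auto simp: C1_def z_def single_def)
  ultimately have z: "z \<in> H1 G \<rho>" "z b = 1" "\<And>e. e \<notin> insert b (arcs T) \<Longrightarrow> z e = 0"
    using c(1) b by (auto simp: H1_def z_def single_def)
  then show "T_bar_edge G \<rho> T b \<in> H1 G \<rho>" "T_bar_edge G \<rho> T b b = 1"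
    "\<And>e. e \<notin> insert b (arcs T) \<Longrightarrow> T_bar_edge G \<rho> T b e = 0"
    using T_bar_edge_unique[OF T b z] by auto
qed

lemma T_bar_edge_in_H1:
  assumes "rho_spanning_tree G \<rho> T" "b \<in> arcs G"
  shows "T_bar_edge G \<rho> T b \<in> H1 G \<rho>"
proof (cases "b \<in> arcs T")
  case True
  then show ?thesis by (simp add: T_bar_edge_def H1_def C1_def bdry_eq_edge_bdry)
qed (use T_bar_edge_props assms in blast)

text \<open>
  Off the tree, only the edge \<open>e\<close> itself contributes to the value of \<open>T_bar G \<rho> T s\<close> at \<open>e\<close>, and it contributes
  \<open>s e\<close>. Hence \<open>s\<close> and its image differ by a cycle of the tree.
\<close>

lemma T_bar_fixes_cycles:
  assumes T: "rho_spanning_tree G \<rho> T" and s: "s \<in> H1 G \<rho>"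
  shows "T_bar G \<rho> T s = s"
proof -
  have T1: "T_bar G \<rho> T s \<in> H1 G \<rho>"
    unfolding T_bar_def by (rule H1_combination) (rule T_bar_edge_in_H1[OF T])
  have "(\<lambda>e. s e - 1 * T_bar G \<rho> T s e) = (\<lambda>_. 0)"
  proof (rule tree_cycle_zero[OF T H1_diff_scale[OF s T1]])
    fix e assume e: "e \<notin> arcs T"
    show "s e - 1 * T_bar G \<rho> T s e = 0"
    proof (cases "e \<in> arcs G")
      case True
      have "s b * T_bar_edge G \<rho> T b e = (if b = e then s b else 0)" if "b \<in> arcs G" for b
        using T_bar_edge_props[OF T that] e by (cases "b \<in> arcs T") (auto simp: T_bar_edge_def)
      then show ?thesis using True by (simp add: T_bar_def sum.delta')
    next
      case False
      then show ?thesis using s T1 by (auto simp: H1_def C1_def)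
    qed
  qed
  then have "T_bar G \<rho> T s e = s e" for e by (metis eq_iff_diff_eq_0 mult_1)
  then show ?thesis by (rule ext)
qed

section \<open>Exchanging an edge\<close>

definition exchange :: "'b \<Rightarrow> 'b \<Rightarrow> ('a,'b) pre_digraph \<Rightarrow> ('a,'b) pre_digraph" where
  "exchange a b T = T\<lparr>arcs := insert a (arcs T - {b})\<rparr>"

lemma exchange_exchange:
  assumes "a \<notin> arcs T" "b \<in> arcs T"
  shows "exchange b a (exchange a b T) = T"
  using assms by (intro pre_digraph.equality) (auto simp: exchange_def)

context
  fixes T a b z
  assumes T: "rho_spanning_tree G \<rho> T" and a: "a \<in> arcs G" "a \<notin> arcs T" and b: "b \<in> arcs T"
  defines "z \<equiv> T_bar_edge G \<rho> T a"
  assumes zb: "z b \<noteq> 0"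
begin

lemma fundamental_cycle: "z \<in> H1 G \<rho>" "z a = 1" "\<And>e. e \<notin> insert a (arcs T) \<Longrightarrow> z e = 0"
  using T_bar_edge_props[OF T a] by (auto simp: z_def)

text \<open>
  The cycle \<open>z\<close> expresses the boundary of \<open>b\<close> by those of the edges of the new tree, so this is the exchange
  step for bases.
\<close>

lemma exchange_tree: "rho_spanning_tree G \<rho> (exchange a b T)"
proof -
  have bG: "b \<in> arcs G" "b \<noteq> a" using b tree_properties(6)[OF T] a by auto
  have sp: "spanning (exchange a b T) G"
    unfolding exchange_def using a tree_properties[OF T] by (intro spanning_update_arcs) auto
  have arcs: "arcs (exchange a b T) = insert a (arcs T - {b})" by (simp add: exchange_def)
  have "c = (\<lambda>_. 0)" if "c \<in> H1 (exchange a b T) \<rho>" for c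
  proof -
    have c: "c \<in> H1 G \<rho>" "\<And>e. e \<notin> insert a (arcs T - {b}) \<Longrightarrow> c e = 0"
      using that spanning_H1_iff[OF sp] arcs by auto
    have "(\<lambda>e. c e - c a * z e) = (\<lambda>_. 0)"
    proof (rule tree_cycle_zero[OF T H1_diff_scale[OF c(1) fundamental_cycle(1)]])
      show "c e - c a * z e = 0" if "e \<notin> arcs T" for e
        using that c(2)[of e] fundamental_cycle(2) fundamental_cycle(3)[of e] by (cases "e = a") auto
    qed
    then have *: "c e = c a * z e" for e by (metis eq_iff_diff_eq_0)
    have "c b = 0" using c(2)[of b] bG by simp
    then have "c a = 0" using *[of b] zb by simp
    then have "c e = 0" for e using *[of e] by simp
    then show ?thesis by (rule ext)
  qed
  moreover have "(\<lambda>_. 0) \<in> H1 (exchange a b T) \<rho>" by (simp add: H1_def C1_def bdry_eq_edge_bdry)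
  ultimately have "H1 (exchange a b T) \<rho> = {\<lambda>_. 0}" by blast
  moreover have "B0 (exchange a b T) \<rho> = C0 G"
  proof (rule spanning_B0_eq_C0I[OF sp])
    fix x assume "x \<in> C0 G"
    then obtain c where c: "\<And>e. e \<notin> arcs T \<Longrightarrow> c e = 0" "bdry G \<rho> c = x"
      using tree_boundary[OF T] by metis
    define c' where "c' = (\<lambda>e. c e - (c b / z b) * z e)"
    have "bdry G \<rho> c' = x"
      unfolding c'_def bdry_diff_scale using fundamental_cycle(1) c(2) by (simp add: H1_def)
    moreover have "c' e = 0" if "e \<notin> arcs (exchange a b T)" for e
    proof (cases "e = b")
      case True
      then show ?thesis using zb by (simp add: c'_def)
    next
      case False
      then show ?thesis using that c(1)[of e] fundamental_cycle(3)[of e] unfolding arcs by (simp add: c'_def)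
    qed
    ultimately show "\<exists>c. (\<forall>e. e \<notin> arcs (exchange a b T) \<longrightarrow> c e = 0) \<and> bdry G \<rho> c = x" by blast
  qed
  ultimately show ?thesis using sp by (simp add: rho_spanning_tree_iff)
qed

lemma exchange_T_bar_edge: "T_bar_edge G \<rho> (exchange a b T) b = (\<lambda>e. z e / z b)"
proof (rule T_bar_edge_unique[OF exchange_tree])
  show "b \<in> arcs G" using b tree_properties(6)[OF T] by auto
  show "b \<notin> arcs (exchange a b T)" using a b by (auto simp: exchange_def)
  show "(\<lambda>e. z e / z b) \<in> H1 G \<rho>"
    using H1_combination[of "{()}" "\<lambda>_. z" "\<lambda>_. inverse (z b)"] fundamental_cycle(1) by (simp add: field_simps)
  show "z b / z b = 1" using zb by simp
  show "z e / z b = 0" if "e \<notin> insert b (arcs (exchange a b T))" for e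
    using that fundamental_cycle(3) by (auto simp: exchange_def)
qed

text \<open>
  The relation \<open>bdry z = 0\<close> expands the boundary of \<open>a\<close> in the basis given by \<open>T\<close>, with coefficient \<open>- z b\<close> at
  \<open>b\<close>. Replacing the row of \<open>b\<close> by that of \<open>a\<close> multiplies the determinant by this coefficient.
\<close>

lemma exchange_rho_hat: "rho_hat \<rho> (exchange a b T) = rho_hat \<rho> T * of_real ((cmod (z b))\<^sup>2)"
proof -
  note t = tree_properties[OF T] and t' = tree_properties[OF exchange_tree]
  let ?V = "verts G" and ?d = "edge_bdry G \<rho>"
  have edge: "edge_bdry T \<rho> = ?d" "edge_bdry (exchange a b T) \<rho> = ?d"
    using t(3,4) t'(3,4) by (auto simp: edge_bdry_def fun_eq_iff)
  obtain f where f: "bij_betw f ?V (arcs T)"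
    "rho_hat \<rho> T = of_real ((cmod (det_on ?V (\<lambda>v. ?d (f v))))\<^sup>2)"
    using twisted_graph.rho_hat_eq_det_ex[OF t(2,7,8)] unfolding edge t(5) by blast
  have inj: "inj_on f ?V" "f ` ?V = arcs T" using f(1) by (auto simp: bij_betw_def)
  obtain v where v: "v \<in> ?V" "f v = b" using inj(2) b by (metis imageE)
  have f': "bij_betw (f(v := a)) ?V (arcs (exchange a b T))"
  proof -
    have "bij_betw f (?V - {v}) (arcs T - {b})"
      using bij_betw_DiffI[OF f(1), of "{v}" "{b}"] v b by (simp add: bij_betw_def)
    then have "bij_betw (f(v := a)) (?V - {v}) (arcs T - {b})"
      by (rule bij_betw_cong[THEN iffD1, rotated]) simp
    from notIn_Un_bij_betw[OF _ _ this, of v] show ?thesis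
      using v(1) a(2) by (simp add: exchange_def insert_absorb)
  qed
  have "?d a = (\<lambda>x. \<Sum>w\<in>?V. - z (f w) * ?d (f w) x)"
  proof
    fix x
    have "0 = (\<Sum>e\<in>arcs G. z e * ?d e x)"
      using fundamental_cycle(1) by (simp add: H1_def bdry_eq_edge_bdry fun_eq_iff)
    also have "\<dots> = (\<Sum>e\<in>insert a (arcs T). z e * ?d e x)"
      using fundamental_cycle(3) a t(6) by (intro sum.mono_neutral_right) auto
    also have "\<dots> = ?d a x + (\<Sum>e\<in>arcs T. z e * ?d e x)"
      using a fundamental_cycle(2) finite_subset[OF t(6)] by simp
    also have "(\<Sum>e\<in>arcs T. z e * ?d e x) = (\<Sum>w\<in>?V. z (f w) * ?d (f w) x)"
      by (rule sum.reindex_bij_betw[OF f(1), of "\<lambda>e. z e * ?d e x", symmetric])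
    finally have "?d a x = - (\<Sum>w\<in>?V. z (f w) * ?d (f w) x)" by (simp add: eq_neg_iff_add_eq_0)
    then show "?d a x = (\<Sum>w\<in>?V. - z (f w) * ?d (f w) x)" by (simp add: sum_negf)
  qed
  then have "(\<lambda>w. ?d ((f(v := a)) w)) = (\<lambda>w. ?d (f w))(v := \<lambda>x. \<Sum>w\<in>?V. - z (f w) * ?d (f w) x)"
    by (auto simp: fun_eq_iff)
  then have "det_on ?V (\<lambda>w. ?d ((f(v := a)) w)) = - z b * det_on ?V (\<lambda>w. ?d (f w))"
    using det_on_pivot[OF finite_verts v(1), of "\<lambda>w. ?d (f w)" "\<lambda>w. - z (f w)"] v(2) by simp
  moreover have "rho_hat \<rho> (exchange a b T) = of_real ((cmod (det_on ?V (\<lambda>w. ?d ((f(v := a)) w))))\<^sup>2)"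
    using twisted_graph.rho_hat_eq_det[OF t'(2,7,8)] f' unfolding edge t'(5) by blast
  ultimately show ?thesis by (simp add: f(2) norm_mult power_mult_distrib)
qed

text \<open>
  The resistances of the edges common to both trees enter equally, and multiplying by \<open>r b\<close> and \<open>r a\<close>
  respectively removes those of the exchanged edges.
  What remains is that \<open>z b\<close> equals its squared modulus times the conjugate of \<open>1 / z b\<close>.
\<close>

lemma exchange_weight:
  "tree_weight \<rho> r T * T_bar_edge G \<rho> T a b * of_real (r b)
    = cnj (tree_weight \<rho> r (exchange a b T) * T_bar_edge G \<rho> (exchange a b T) b a * of_real (r a))"
proof -
  note t = tree_properties[OF T]
  obtain s where s: "rho_hat \<rho> T = of_real s" using twisted_graph.rho_hat_pos[OF t(2,7,8)] by blast
  have fin: "finite (arcs T)" using finite_subset[OF t(6)] by simp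
  define k where "k = (\<Prod>e\<in>arcs T - {b}. inverse (r e))"
  have pos: "r a \<noteq> 0" "r b \<noteq> 0" using resistance_pos[OF a(1)] resistance_pos[of b] t(6) b by auto
  have "tree_weight \<rho> r T = of_real (s * (inverse (r b) * k))"
    using prod.remove[OF fin b, of "\<lambda>e. inverse (r e)"] by (simp add: tree_weight_def s k_def flip: of_real_inverse of_real_prod)
  moreover have "tree_weight \<rho> r (exchange a b T) = of_real (s * (cmod (z b))\<^sup>2 * (inverse (r a) * k))"
    unfolding tree_weight_def exchange_rho_hat using fin a by (simp add: exchange_def s k_def)
  moreover have "(of_real (cmod (z b)))\<^sup>2 = z b * cnj (z b)"
    using complex_norm_square[of "z b"] by simp
  ultimately show ?thesis
    unfolding exchange_T_bar_edge fundamental_cycle(2) z_def[symmetric] using pos zb by (simp add: field_simps)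
qed

end

section \<open>The weighted average of the projections\<close>

text \<open>
  Off the diagonal the trees that contribute are matched by \<open>exchange\<close>; on the diagonal the entries of
  \<open>T_bar\<close> are 0 or 1 and the weights are real.
\<close>

lemma weighted_sum_hermitian:
  assumes a: "a \<in> arcs G" and b: "b \<in> arcs G"
  shows "(\<Sum>T | rho_spanning_tree G \<rho> T. tree_weight \<rho> r T * T_bar_edge G \<rho> T a b) * of_real (r b)
    = cnj ((\<Sum>T | rho_spanning_tree G \<rho> T. tree_weight \<rho> r T * T_bar_edge G \<rho> T b a) * of_real (r a))"
proof -
  let ?t = "\<lambda>a b T. tree_weight \<rho> r T * T_bar_edge G \<rho> T a b * of_real (r b)"
  have "(\<Sum>T | rho_spanning_tree G \<rho> T. ?t a b T) = (\<Sum>T | rho_spanning_tree G \<rho> T. cnj (?t b a T))"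
  proof (cases "a = b")
    case True
    have "?t a a T = cnj (?t a a T)" if T: "rho_spanning_tree G \<rho> T" for T
    proof -
      obtain w where "tree_weight \<rho> r T = of_real w" using tree_weight_pos[OF T] by blast
      then show ?thesis
        using T_bar_edge_props(2)[OF T a] by (cases "a \<in> arcs T") (simp_all add: T_bar_edge_def)
    qed
    then show ?thesis unfolding True by (intro sum.cong) auto
  next
    case False
    define X where "X a b = {T. rho_spanning_tree G \<rho> T \<and> a \<notin> arcs T \<and> b \<in> arcs T \<and> T_bar_edge G \<rho> T a b \<noteq> 0}" for a b
    have restrict: "(\<Sum>T | rho_spanning_tree G \<rho> T. ?t a b T) = (\<Sum>T\<in>X a b. ?t a b T)"
      if "a \<in> arcs G" "a \<noteq> b" for a b
    proof (rule sum.mono_neutral_right[OF finite_trees])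
      show "\<forall>T\<in>{T. rho_spanning_tree G \<rho> T} - X a b. ?t a b T = 0"
      proof
        fix T assume T: "T \<in> {T. rho_spanning_tree G \<rho> T} - X a b"
        then have "T_bar_edge G \<rho> T a b = 0"
          using T_bar_edge_props(3)[of T a b] that
          by (cases "a \<in> arcs T") (auto simp: X_def T_bar_edge_def)
        then show "?t a b T = 0" by simp
      qed
    qed (auto simp: X_def)
    have step: "exchange a b T \<in> X b a" "exchange b a (exchange a b T) = T"
      "cnj (?t b a (exchange a b T)) = ?t a b T"
      if "a \<in> arcs G" "T \<in> X a b" for a b T
    proof -
      have T: "rho_spanning_tree G \<rho> T" "a \<notin> arcs T" "b \<in> arcs T" "T_bar_edge G \<rho> T a b \<noteq> 0"
        using that(2) by (auto simp: X_def)
      note h = T(1) that(1) T(2,3,4)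
      show "exchange b a (exchange a b T) = T" using T(2,3) by (rule exchange_exchange)
      show "cnj (?t b a (exchange a b T)) = ?t a b T" using exchange_weight[OF h] by simp
      have "a \<noteq> b" using T by auto
      then show "exchange a b T \<in> X b a"
        using exchange_tree[OF h] exchange_T_bar_edge[OF h] T T_bar_edge_props(2)[OF T(1) that(1) T(2)]
        by (simp add: X_def) (simp add: exchange_def)
    qed
    have "(\<Sum>T\<in>X a b. ?t a b T) = (\<Sum>T\<in>X b a. cnj (?t b a T))"
      by (rule sum.reindex_bij_witness[where i="exchange b a" and j="exchange a b"])
        (use step[OF a] step[OF b] in auto)
    then show ?thesis using restrict[OF a False] restrict[OF b False[symmetric]] by (metis cnj_sum)
  qed
  then show ?thesis by (simp add: sum_distrib_right)
qed

text \<open>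
  A self-adjoint map with values in a subspace that fixes every vector of the subspace is the orthogonal
  projection: the inner product of \<open>P x\<close> with \<open>s\<close> is that of \<open>x\<close> with \<open>P s\<close>, that is, with \<open>s\<close>.
\<close>

theorem tree_average_is_projection:
  "orthogonal_projection (inner_R G r) (C1 G) (H1 G \<rho>)
    (\<lambda>x e. 1 / total_weight G \<rho> r *
      (\<Sum>T | rho_spanning_tree G \<rho> T. tree_weight \<rho> r T * T_bar G \<rho> T x e))"
proof -
  let ?Tr = "{T. rho_spanning_tree G \<rho> T}"
  obtain \<Delta> where \<Delta>: "\<Delta> > 0" "total_weight G \<rho> r = of_real \<Delta>" using total_weight_pos by blast
  define P where "P x e = 1 / total_weight G \<rho> r * (\<Sum>T\<in>?Tr. tree_weight \<rho> r T * T_bar G \<rho> T x e)" for x e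
  define M where "M a b = (\<Sum>T\<in>?Tr. tree_weight \<rho> r T * T_bar_edge G \<rho> T a b) / of_real \<Delta>" for a b
  have P_M: "P x e = (\<Sum>a\<in>arcs G. x a * M a e)" for x e
  proof -
    have "(\<Sum>T\<in>?Tr. tree_weight \<rho> r T * T_bar G \<rho> T x e)
        = (\<Sum>T\<in>?Tr. \<Sum>a\<in>arcs G. x a * (tree_weight \<rho> r T * T_bar_edge G \<rho> T a e))"
      by (simp add: T_bar_def sum_distrib_left mult.left_commute)
    also have "\<dots> = (\<Sum>a\<in>arcs G. x a * (\<Sum>T\<in>?Tr. tree_weight \<rho> r T * T_bar_edge G \<rho> T a e))"
      by (subst sum.swap) (simp add: sum_distrib_left)
    finally show ?thesis by (simp add: P_def M_def \<Delta>(2) sum_divide_distrib[symmetric])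
  qed
  have herm: "M a b * of_real (r b) = cnj (M b a) * of_real (r a)" if "a \<in> arcs G" "b \<in> arcs G" for a b
    using weighted_sum_hermitian[OF that] by (simp add: M_def field_simps)
  have "M a \<in> H1 G \<rho>" if "a \<in> arcs G" for a
  proof -
    have "(\<lambda>e. \<Sum>T\<in>?Tr. (tree_weight \<rho> r T / of_real \<Delta>) * T_bar_edge G \<rho> T a e) \<in> H1 G \<rho>"
      using T_bar_edge_in_H1 that by (intro H1_combination) simp
    then show ?thesis by (simp add: M_def[abs_def] sum_divide_distrib)
  qed
  then have P_H1: "P x \<in> H1 G \<rho>" for x
    using H1_combination[of "arcs G" M x] by (simp add: P_M[abs_def])
  have P_id: "P s = s" if "s \<in> H1 G \<rho>" for s
  proof
    fix e
    have "(\<Sum>T\<in>?Tr. tree_weight \<rho> r T * T_bar G \<rho> T s e) = total_weight G \<rho> r * s e"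
      using T_bar_fixes_cycles[OF _ that] by (simp add: total_weight_def sum_distrib_right)
    then show "P s e = s e" using \<Delta> by (simp add: P_def)
  qed
  have "inner_R G r (x - P x) s = 0" if s: "s \<in> H1 G \<rho>" for x s
  proof -
    have "inner_R G r (P x) s = (\<Sum>b\<in>arcs G. \<Sum>a\<in>arcs G. x a * (M a b * of_real (r b)) * cnj (s b))"
      by (simp add: inner_R_def P_M sum_distrib_left sum_distrib_right mult.assoc mult.commute mult.left_commute)
    also have "\<dots> = (\<Sum>a\<in>arcs G. \<Sum>b\<in>arcs G. x a * (cnj (M b a) * of_real (r a)) * cnj (s b))"
      by (subst sum.swap) (simp add: herm)
    also have "\<dots> = (\<Sum>a\<in>arcs G. of_real (r a) * x a * cnj (P s a))"
      by (simp add: P_M sum_distrib_left sum_distrib_right mult.assoc mult.commute mult.left_commute)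
    also have "\<dots> = inner_R G r x s" by (simp add: P_id[OF s] inner_R_def)
    finally show ?thesis
      by (simp add: inner_R_def left_diff_distrib right_diff_distrib sum_subtractf)
  qed
  then show ?thesis
    using P_H1 unfolding orthogonal_projection_def P_def[abs_def] by blast
qed

end

theorem theorem1:
  fixes G :: "('v, 'e) pre_digraph"
    and \<rho> :: "'e \<Rightarrow> complex"
    and r :: "'e \<Rightarrow> real"
  assumes "fin_digraph G"
    and "Digraph_Component.connected G"
    and "line_bundle G \<rho>"
    and "H0_vanishes G \<rho>"
    and "\<And>b. b \<in> arcs G \<Longrightarrow> r b > 0"
  shows "total_weight G \<rho> r \<noteq> 0 \<and>
    orthogonal_projection (inner_R G r) (C1 G) (H1 G \<rho>)
      (\<lambda>x e. 1 / total_weight G \<rho> r *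
         (\<Sum>T | rho_spanning_tree G \<rho> T. tree_weight \<rho> r T * T_bar G \<rho> T x e))"
proof -
  interpret fin_digraph G by fact
  interpret twisted_graph G \<rho>
    using assms(3) by unfold_locales (simp add: line_bundle_def)
  interpret resistor_network G \<rho> r
  proof
    show "B0 G \<rho> = C0 G"
      using boundaries_if_H0_singleton assms(4) by (simp add: H0_vanishes_def)
  qed (rule assms(5))
  show ?thesis using total_weight_pos tree_average_is_projection by auto
qed

end
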